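(* Let $k$ be a positive integer. The function $\deg_1:\mathcal{I}_\infty^k\to\mathbb{N}$ defined on the basis elements of $\mathcal{I}_\infty^k$ by $$\deg_1(\mathbf{C}_\Lambda)=|\Lambda|+m_1(\Lambda(1^k))$$ is a filtration on $\mathcal{I}_\infty^k$.
   Context: Fix a positive integer $k$. For $i\ge1$ let $p_k(i)=\{(i-1)k+1,\dots,ik\}$; such a set is called a $k$-tuple. For a finite disjoint union $d$ of $k$-tuples, $\mathcal{B}_d^k$ is the group of permutations of $d$ that permute the $k$-tuples contained in $d$. A family of partitions is $\Lambda=(\Lambda(\lambda))_{\lambda\vdash k}$, where each $\Lambda(\lambda)$ is a (possibly empty) partition; $|\Lambda|=\sum_{\lambda\vdash k}|\Lambda(\lambda)|$. $(1^k)$ is the partition of $k$ with all parts $1$, and $m_1(\mu)$ is the number of parts equal to $1$ in a partition $\mu$. Type: for $\omega\in\mathcal{B}_d^k$, consider each cycle, of length $m$ say, of the permutation induced by $\omega$ on the $k$-tuples of $d$. The union of the $k$-tuples in this cycle is a union of cycles of $\omega$; choose one of these $k$-tuples $p_k(i)$ and let $\rho\vdash k$ be the partition formed by the numbers of elements of $p_k(i)$ lying in each of these cycles of $\omega$ (independent of $i$). This contributes one part $m$ to a partition denoted $\omega(\rho)$. The type of $\omega$ is the family $(\omega(\rho))_{\rho\vdash k}$. A $k$-partial permutation is a pair $(d,\omega)$ with $d$ a finite disjoint union of $k$-tuples and $\omega\in\mathcal{B}_d^k$; its type is the type of $\omega$. The product is $(d_1,\omega_1)(d_2,\omega_2)=(d_1\cup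 d_2,\omega_1\omega_2)$, with $\omega_1,\omega_2$ extended by the identity to $d_1\cup d_2$. $\mathcal{I}_\infty^k$ is the algebra of finite complex linear combinations of the formal (infinite) sums $\mathbf{C}_\Lambda=\sum(d,\omega)$ over all $k$-partial permutations $(d,\omega)$ of type $\Lambda$ (so $d$ consists of $|\Lambda|$ $k$-tuples), for all families $\Lambda$; the $\mathbf{C}_\Lambda$ form a basis. A degree function given on the basis is extended to a nonzero element as the maximum of the degrees of the basis elements occurring in it with nonzero coefficient (the zero element having degree $-\infty$ by convention). It is a filtration if the degree of a product $xy$ is at most the sum of the degrees of $x$ and $y$; equivalently, every $\mathbf{C}_\Gamma$ occurring with nonzero coefficient in $\mathbf{C}_\Lambda\mathbf{C}_\Delta$ has degree at most the sum of the degrees of $\mathbf{C}_\Lambda$ and $\mathbf{C}_\Delta$. *)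

theory Defs
  imports "HOL-Analysis.Analysis" "HOL-Library.Multiset" "HOL-Combinatorics.Combinatorics"
begin

text \<open>A partition is the multiset of its (positive) parts.\<close>

definition is_partition :: "nat multiset \<Rightarrow> bool" where
  "is_partition \<mu> \<longleftrightarrow> 0 \<notin># \<mu>"

definition partitions_of :: "nat \<Rightarrow> nat multiset set" where
  "partitions_of n = {\<mu>. is_partition \<mu> \<and> \<Sum>\<^sub># \<mu> = n}"

definition m1 :: "nat multiset \<Rightarrow> nat" where
  "m1 \<mu> = count \<mu> 1"

type_synonym family = "nat multiset \<Rightarrow> nat multiset"

text \<open>A family indexed by the partitions of \<open>k\<close> is a total function, with the value \<open>{#}\<close> outside its
  index set, so that equality of families is equality of functions.\<close>

definition families :: "nat \<Rightarrow> family set" where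
  "families k = {\<Lambda>. (\<forall>\<rho> \<in> partitions_of k. is_partition (\<Lambda> \<rho>)) \<and>
                    (\<forall>\<rho>. \<rho> \<notin> partitions_of k \<longrightarrow> \<Lambda> \<rho> = {#})}"

definition family_size :: "nat \<Rightarrow> family \<Rightarrow> nat" where
  "family_size k \<Lambda> = (\<Sum>\<rho>\<in>partitions_of k. \<Sum>\<^sub># (\<Lambda> \<rho>))"

lemma finite_partitions_of: "finite (partitions_of k)"
proof -
  have "partitions_of k \<subseteq> mset ` {xs. set xs \<subseteq> {1..k} \<and> length xs \<le> k}"
  proof
    fix \<mu> assume "\<mu> \<in> partitions_of k"
    then have z: "0 \<notin># \<mu>" and s: "\<Sum>\<^sub># \<mu> = k"
      by (auto simp: partitions_of_def is_partition_def)
    obtain xs where xs: "mset xs = \<mu>" using ex_mset by blast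
    have sl: "sum_list xs = k" using s xs by (metis sum_mset_sum_list)
    have pos: "x \<ge> 1" if "x \<in> set xs" for x
      using z xs that by (metis gr0I less_one not_le set_mset_mset)
    have le: "x \<le> k" if "x \<in> set xs" for x
      using member_le_sum_list[OF that] sl by simp
    have "length ys \<le> sum_list ys" if "\<forall>x \<in> set ys. 1 \<le> x" for ys :: "nat list"
      using that by (induction ys) auto
    then have "length xs \<le> k" using pos sl by blast
    with pos le xs show "\<mu> \<in> mset ` {xs. set xs \<subseteq> {1..k} \<and> length xs \<le> k}" by force
  qed
  moreover have "finite {xs. set xs \<subseteq> {1..k} \<and> length xs \<le> k}"
    by (rule finite_lists_length_le) simp
  ultimately show ?thesis by (blast intro: finite_subset)
qed

definition ktuple :: "nat \<Rightarrow> nat \<Rightarrow> nat set" where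
  "ktuple k i = {(i - 1) * k + 1..i * k}"

definition ktuples :: "nat \<Rightarrow> nat set set" where
  "ktuples k = ktuple k ` {1..}"

definition ktuples_in :: "nat \<Rightarrow> nat set \<Rightarrow> nat set set" where
  "ktuples_in k d = {p \<in> ktuples k. p \<subseteq> d}"

definition ktuple_domain :: "nat \<Rightarrow> nat set \<Rightarrow> bool" where
  "ktuple_domain k d \<longleftrightarrow> (\<exists>P. finite P \<and> P \<subseteq> ktuples k \<and> d = \<Union>P)"

text \<open>A permutation of \<open>d\<close> is a function fixing every point outside \<open>d\<close> (as in \<^const>\<open>permutes\<close>); in
  particular it is already extended by the identity to every larger set.\<close>

definition B_group :: "nat \<Rightarrow> nat set \<Rightarrow> (nat \<Rightarrow> nat) set" where
  "B_group k d = {\<omega>. \<omega> permutes d \<and> (\<forall>p \<in> ktuples_in k d. \<omega> ` p \<in> ktuples_in k d)}"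

type_synonym pperm = "nat set \<times> (nat \<Rightarrow> nat)"

definition kpperms :: "nat \<Rightarrow> pperm set" where
  "kpperms k = {(d, \<omega>). ktuple_domain k d \<and> \<omega> \<in> B_group k d}"

definition pperm_mult :: "pperm \<Rightarrow> pperm \<Rightarrow> pperm" where
  "pperm_mult x y = (fst x \<union> fst y, snd x \<circ> snd y)"

text \<open>The cycles of \<open>\<omega>\<close> are the sets \<open>orbit \<omega> x\<close>, and the permutation induced by \<open>\<omega>\<close> on tuples is
  \<open>(`) \<omega>\<close>. Cycles are recorded as sets; the length of a cycle is its cardinality.\<close>

definition tuple_cycles :: "nat \<Rightarrow> pperm \<Rightarrow> nat set set set" where
  "tuple_cycles k x = (\<lambda>p. orbit ((`) (snd x)) p) ` ktuples_in k (fst x)"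

definition tuple_partition :: "(nat \<Rightarrow> nat) \<Rightarrow> nat set \<Rightarrow> nat multiset" where
  "tuple_partition \<omega> p = image_mset (\<lambda>c. card (c \<inter> p)) (mset_set (orbit \<omega> ` p))"

definition cycle_partition :: "(nat \<Rightarrow> nat) \<Rightarrow> nat set set \<Rightarrow> nat multiset" where
  "cycle_partition \<omega> C = tuple_partition \<omega> (SOME p. p \<in> C)"

definition ptype :: "nat \<Rightarrow> pperm \<Rightarrow> family" where
  "ptype k x = (\<lambda>\<rho>. image_mset card
     (mset_set {C \<in> tuple_cycles k x. cycle_partition (snd x) C = \<rho>}))"

text \<open>A formal, possibly infinite, sum of \<open>k\<close>-partial permutations is its coefficient function,
  vanishing outside \<^term>\<open>kpperms k\<close>.\<close>

type_synonym formal_sum = "pperm \<Rightarrow> complex"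

definition C_basis :: "nat \<Rightarrow> family \<Rightarrow> formal_sum" where
  "C_basis k \<Lambda> = (\<lambda>x. if x \<in> kpperms k \<and> ptype k x = \<Lambda> then 1 else 0)"

definition coeff_families :: "nat \<Rightarrow> (family \<Rightarrow> complex) set" where
  "coeff_families k = {a. finite {\<Lambda>. a \<Lambda> \<noteq> 0} \<and> {\<Lambda>. a \<Lambda> \<noteq> 0} \<subseteq> families k}"

definition lin_comb :: "nat \<Rightarrow> (family \<Rightarrow> complex) \<Rightarrow> formal_sum" where
  "lin_comb k a = (\<lambda>x. \<Sum>\<Lambda> | a \<Lambda> \<noteq> 0. a \<Lambda> * C_basis k \<Lambda> x)"

definition I_inf :: "nat \<Rightarrow> formal_sum set" where
  "I_inf k = lin_comb k ` coeff_families k"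

definition I_mult :: "nat \<Rightarrow> formal_sum \<Rightarrow> formal_sum \<Rightarrow> formal_sum" where
  "I_mult k f g = (\<lambda>z. \<Sum>(x, y) | x \<in> kpperms k \<and> y \<in> kpperms k \<and> pperm_mult x y = z. f x * g y)"

lemma finite_factorisations:
  "finite {(x, y). x \<in> kpperms k \<and> y \<in> kpperms k \<and> pperm_mult x y = z}"
proof (cases "finite (fst z)")
  case True
  let ?S = "Sigma (Pow (fst z)) (\<lambda>d. {\<omega>. \<omega> permutes d})"
  have "finite ?S"
    using True by (intro finite_SigmaI finite_permutations) (auto intro: finite_subset)
  then have "finite (?S \<times> ?S)" by simp
  moreover have "{(x, y). x \<in> kpperms k \<and> y \<in> kpperms k \<and> pperm_mult x y = z} \<subseteq> ?S \<times> ?S"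
    by (auto simp: kpperms_def B_group_def pperm_mult_def)
  ultimately show ?thesis by (rule finite_subset[rotated])
next
  case False
  have fin: "finite (fst x)" if "x \<in> kpperms k" for x
  proof -
    obtain P where "finite P" "P \<subseteq> ktuples k" "fst x = \<Union>P"
      using \<open>x \<in> kpperms k\<close> by (auto simp: kpperms_def ktuple_domain_def)
    moreover have "finite p" if "p \<in> ktuples k" for p
      using that by (auto simp: ktuples_def ktuple_def)
    ultimately show ?thesis by (metis finite_Union subsetD)
  qed
  have "{(x, y). x \<in> kpperms k \<and> y \<in> kpperms k \<and> pperm_mult x y = z} = {}"
    using fin False by (fastforce simp: pperm_mult_def)
  then show ?thesis by (simp only: finite.emptyI)
qed

text \<open>The coefficients of an element in the basis \<open>C_basis k\<close>. The value is unspecified, not zero, if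
  an argument has no or no unique expansion, so a bound on the degree of a product also
  depends on the product lying in \<open>I_inf k\<close>.\<close>

definition basis_coeff :: "nat \<Rightarrow> formal_sum \<Rightarrow> family \<Rightarrow> complex" where
  "basis_coeff k f = (THE a. a \<in> coeff_families k \<and> lin_comb k a = f)"

definition extend_degree :: "nat \<Rightarrow> (family \<Rightarrow> nat) \<Rightarrow> formal_sum \<Rightarrow> ereal" where
  "extend_degree k \<delta> f =
     (if f = (\<lambda>_. 0) then - \<infinity>
      else ereal (real (Max (\<delta> ` {\<Lambda>. basis_coeff k f \<Lambda> \<noteq> 0}))))"

definition filtration_on ::
    "'a set \<Rightarrow> ('a \<Rightarrow> 'a \<Rightarrow> 'a) \<Rightarrow> ('a \<Rightarrow> ereal) \<Rightarrow> bool" where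
  "filtration_on A m deg \<longleftrightarrow> (\<forall>x \<in> A. \<forall>y \<in> A. deg (m x y) \<le> deg x + deg y)"

definition deg1_basis :: "nat \<Rightarrow> family \<Rightarrow> nat" where
  "deg1_basis k \<Lambda> = family_size k \<Lambda> + m1 (\<Lambda> (replicate_mset k 1))"

definition deg1 :: "nat \<Rightarrow> formal_sum \<Rightarrow> ereal" where
  "deg1 k = extend_degree k (deg1_basis k)"

end

theory Submission
  imports Defs
begin

text \<open>Partial permutations of the same type are conjugate by a bijection of their domains that maps
  tuples to tuples, and every family is the type of some partial permutation. Hence the coefficient
  of a product at a partial permutation depends only on its type, products lie in \<^const>\<open>I_inf\<close>, and
  expansions in the basis are unique.

  On a partial permutation \<open>(d, \<omega>)\<close> the degree is the number of tuples in \<open>d\<close> plus the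
  number of tuples fixed pointwise by \<open>\<omega>\<close>. In a product, a fixed tuple either lies in both domains, and
  is then counted twice on the right-hand side already, or it lies in one domain only, and is then
  fixed by that factor.\<close>

subsection \<open>Multisets and orbits\<close>

text \<open>A type consists of multisets only, so it does not say which cycle of one partial
  permutation should go to which cycle of another. The obstacle is to pass from equal multisets to a
  single bijection that respects the cycles and the tuples at once. A standard model built from a
  list of cycle data mediates: every partial permutation is identified with the model of any valid
  list representing its type, and two identifications with the same model compose to the conjugating
  bijection. The same device produces a partial permutation of each type, shows that conjugation
  preserves types, and counts tuples. The inequality of degrees is then a statement about finite
  sets. If A and B are the sets of tuples of the two domains, the product has |A \<union> B| tuples
  and at most |A \<inter> B| fixed tuples besides those fixed in a factor, and |A \<union> B| + |A
  \<inter> B| = |A| + |B|. For a product to lie in \<open>I_inf\<close>, only finitely many types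
  may occur in it; this follows from |A \<union> B| \<le> |A| + |B|.\<close>

lemma image_mset_mset_set_eq_imp_bij:
  assumes "finite A" "finite B"
    and eq: "image_mset f (mset_set A) = image_mset g (mset_set B)"
  obtains h where "bij_betw h A B" "\<And>a. a \<in> A \<Longrightarrow> g (h a) = f a"
proof -
  have "card A = card B"
    using arg_cong[OF eq, of size] by simp
  then obtain b where b: "bij_betw b A B"
    using assms finite_same_card_bij by blast
  \<comment> \<open>The bijection \<open>b\<close> ignores the labels; transporting \<open>g\<close>
    along it leaves two labellings of the same set \<open>A\<close>, which differ by a permutation
    of \<open>A\<close>.\<close>
  have "image_mset f (mset_set A) = image_mset (g \<circ> b) (mset_set A)"
    using eq b by (simp add: bij_betw_def image_mset_mset_set flip: multiset.map_comp)
  then obtain p where p: "p permutes A" "\<forall>x\<in>A. f x = (g \<circ> b) (p x)"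
    using image_mset_eq_implies_permutes[OF assms(1)] by blast
  have "bij_betw (b \<circ> p) A B"
    using b p(1) by (meson bij_betw_trans permutes_imp_bij)
  then show thesis
    using p(2) that by (metis comp_apply)
qed

text \<open>The first return time to \<open>x\<close> is the number of points of its orbit.
  Cardinality is the form needed, because types record cycle lengths as cardinalities. The
  hypothesis says that \<open>x\<close> is periodic.\<close>

lemma orbit_eq_image_lessThan_card:
  assumes "x \<in> orbit f x"
  shows "orbit f x = (\<lambda>i. (f ^^ i) x) ` {..<card (orbit f x)}"
    and "inj_on (\<lambda>i. (f ^^ i) x) {..<card (orbit f x)}"
    and "(f ^^ card (orbit f x)) x = x"
proof -
  let ?N = "funpow_dist1 f x x"
  have o: "orbit f x = (\<lambda>i. (f ^^ i) x) ` {0..<?N}"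
    using assms by (rule orbit_conv_funpow_dist1)
  have inj: "inj_on (\<lambda>i. (f ^^ i) x) {0..<?N}"
    using assms by (rule inj_on_funpow_dist1)
  have N: "card (orbit f x) = ?N"
    unfolding o using inj by (simp add: card_image)
  show "orbit f x = (\<lambda>i. (f ^^ i) x) ` {..<card (orbit f x)}"
    and "inj_on (\<lambda>i. (f ^^ i) x) {..<card (orbit f x)}"
    and "(f ^^ card (orbit f x)) x = x"
    unfolding N lessThan_atLeast0 by (fact o inj funpow_dist1_prop[OF assms])+
qed

lemma card_orbit_pos: "x \<in> orbit f x \<Longrightarrow> 0 < card (orbit f x)"
  using finite_orbit card_gt_0_iff orbit_nonempty by metis

text \<open>Used at two levels: for points under \<omega> and for tuples under the image map of
  \<omega>.\<close>

lemma funpow_eq_iff_mod_card_orbit: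
  assumes "x \<in> orbit f x"
  shows "(f ^^ i) x = (f ^^ j) x \<longleftrightarrow> i mod card (orbit f x) = j mod card (orbit f x)"
proof -
  let ?N = "card (orbit f x)"
  have r: "(f ^^ i) x = (f ^^ (i mod ?N)) x" for i
    using funpow_mod_eq[OF orbit_eq_image_lessThan_card(3)[OF assms]] by metis
  have "(f ^^ (i mod ?N)) x = (f ^^ (j mod ?N)) x \<longleftrightarrow> i mod ?N = j mod ?N"
    using inj_onD[OF orbit_eq_image_lessThan_card(2)[OF assms]] card_orbit_pos[OF assms]
    by (metis lessThan_iff mod_less_divisor)
  then show ?thesis
    using r by metis
qed

lemma funpow_image:
  fixes f :: "'a \<Rightarrow> 'a"
  shows "((`) f ^^ i) A = (f ^^ i) ` A"
  by (induction i) (auto simp: image_comp)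

text \<open>The counting behind tuple partitions: a cycle of m * r points running through a cycle of
  m tuples visits a given tuple at every m-th step, hence r times.\<close>

lemma card_residue_class:
  fixes m :: nat
  assumes "j < m"
  shows "card {i. i < m * r \<and> i mod m = j} = r"
proof -
  have "{i. i < m * r \<and> i mod m = j} = (\<lambda>a. m * a + j) ` {..<r}"
  proof (intro set_eqI iffI)
    fix i assume "i \<in> {i. i < m * r \<and> i mod m = j}"
    then have "i = m * (i div m) + j" "i div m < r"
      using assms by (auto simp: less_mult_imp_div_less mult.commute)
    then show "i \<in> (\<lambda>a. m * a + j) ` {..<r}"
      by blast
  next
    fix i assume "i \<in> (\<lambda>a. m * a + j) ` {..<r}"
    then obtain a where a: "a < r" "i = m * a + j"
      by auto
    have "m * a + j < m * Suc a"
      using assms by simp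
    also have "\<dots> \<le> m * r"
      using a(1) by (intro mult_le_mono2) simp
    finally show "i \<in> {i. i < m * r \<and> i mod m = j}"
      using a assms by simp
  qed
  moreover have "inj_on (\<lambda>a. m * a + j) {..<r}"
    using assms by (intro inj_onI) simp
  ultimately show ?thesis
    by (simp add: card_image)
qed

lemma image_mset_nth_lessThan: "image_mset ((!) xs) (mset_set {..<length xs}) = mset xs"
proof -
  have "mset_set {..<length xs} = mset [0..<length xs]"
    by (simp add: lessThan_atLeast0)
  then show ?thesis
    by (metis map_nth mset_map)
qed

subsection \<open>Tuples and partial permutations\<close>

lemma ktuple_Suc: "ktuple k (Suc i) = {i * k + 1..i * k + k}"
  by (simp add: ktuple_def add.commute)

text \<open>The index of a tuple becomes a quotient, which makes disjointness of tuples immediate.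
  Tuples start at 1, hence the shift; \<open>0 < y\<close> excludes the point 0, which truncated
  subtraction would put into the first tuple.\<close>

lemma mem_ktuple_Suc_iff: "y \<in> ktuple k (Suc i) \<longleftrightarrow> 0 < y \<and> 0 < k \<and> (y - 1) div k = i"
proof (cases "0 < k \<and> 0 < y")
  case True
  then obtain z where z: "y = Suc z"
    using gr0_implies_Suc by blast
  have "i * k \<le> z \<and> z < i * k + k \<longleftrightarrow> z div k = i"
    using True by (metis add.commute div_nat_eqI dividend_less_div_times div_times_less_eq_dividend
        mult.commute mult_Suc_right)
  then show ?thesis
    using True z by (auto simp: ktuple_Suc)
qed (auto simp: ktuple_Suc)

lemma ktuples_alt: "ktuples k = range (\<lambda>i. ktuple k (Suc i))"
proof -
  have "{1..} = range Suc"
    by (auto simp: image_iff) (metis Suc_le_D)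
  then show ?thesis
    by (simp add: ktuples_def image_image)
qed

lemma ktuples_disjoint: "p \<in> ktuples k \<Longrightarrow> q \<in> ktuples k \<Longrightarrow> y \<in> p \<Longrightarrow> y \<in> q \<Longrightarrow> p = q"
  by (auto simp: ktuples_alt mem_ktuple_Suc_iff)

lemma card_ktuple: "p \<in> ktuples k \<Longrightarrow> card p = k"
  by (auto simp: ktuples_alt ktuple_Suc)

lemma finite_ktuple: "p \<in> ktuples k \<Longrightarrow> finite p"
  by (auto simp: ktuples_alt ktuple_Suc)

lemma ktuple_nonempty: "0 < k \<Longrightarrow> p \<in> ktuples k \<Longrightarrow> p \<noteq> {}"
  using card_ktuple by fastforce

lemma ktuple_in_domain_or_disjoint:
  assumes "ktuple_domain k d" "p \<in> ktuples k"
  shows "p \<subseteq> d \<or> p \<inter> d = {}"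
proof (rule ccontr)
  assume c: "\<not> ?thesis"
  obtain P where P: "P \<subseteq> ktuples k" "d = \<Union>P"
    using assms(1) by (auto simp: ktuple_domain_def)
  obtain y q where y: "y \<in> p" "y \<in> q" "q \<in> P"
    using c P(2) by blast
  then have "p = q"
    using assms(2) P(1) ktuples_disjoint by blast
  then show False
    using c P(2) y(3) by blast
qed

lemma ktuple_domain_Union: "ktuple_domain k d \<Longrightarrow> \<Union>(ktuples_in k d) = d"
  by (auto simp: ktuple_domain_def ktuples_in_def)

lemma ktuples_inE:
  assumes "ktuple_domain k d" "y \<in> d"
  obtains p where "p \<in> ktuples_in k d" "y \<in> p"
  using assms ktuple_domain_Union by blast

lemma finite_ktuple_domain: "ktuple_domain k d \<Longrightarrow> finite d"
  using finite_ktuple by (auto simp: ktuple_domain_def subset_iff)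

lemma finite_ktuples_in: "ktuple_domain k d \<Longrightarrow> finite (ktuples_in k d)"
  by (rule finite_subset[of _ "Pow d"]) (auto simp: ktuples_in_def finite_ktuple_domain)

lemma ktuple_domain_Un: "ktuple_domain k d \<Longrightarrow> ktuple_domain k e \<Longrightarrow> ktuple_domain k (d \<union> e)"
  unfolding ktuple_domain_def by (metis Un_subset_iff Union_Un_distrib finite_UnI)

lemma ktuples_in_Un:
  assumes "0 < k" "ktuple_domain k d" "ktuple_domain k e"
  shows "ktuples_in k (d \<union> e) = ktuples_in k d \<union> ktuples_in k e"
proof -
  have "p \<subseteq> d \<or> p \<subseteq> e" if "p \<in> ktuples k" "p \<subseteq> d \<union> e" for p
    using ktuple_in_domain_or_disjoint[OF assms(2) that(1)]
      ktuple_in_domain_or_disjoint[OF assms(3) that(1)] that(2) ktuple_nonempty[OF assms(1) that(1)]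
    by blast
  then show ?thesis
    by (auto simp: ktuples_in_def)
qed

text \<open>Tuples outside \<open>d\<close> are fixed pointwise, so the tuple condition may range
  over all tuples. In this form it does not depend on \<open>d\<close> and passes directly to
  products with different domains.\<close>

lemma kpperms_iff:
  assumes "0 < k"
  shows "(d, \<omega>) \<in> kpperms k \<longleftrightarrow>
    ktuple_domain k d \<and> \<omega> permutes d \<and> (\<forall>p\<in>ktuples k. \<omega> ` p \<in> ktuples k)"
proof -
  have "\<omega> ` p \<in> ktuples k"
    if "ktuple_domain k d" "\<omega> permutes d" "\<forall>p\<in>ktuples_in k d. \<omega> ` p \<in> ktuples_in k d"
      "p \<in> ktuples k" for p
  proof (cases "p \<subseteq> d")
    case False
    then have "p \<inter> d = {}"
      using ktuple_in_domain_or_disjoint that by blast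
    then have "\<forall>y\<in>p. \<omega> y = y"
      using that(2) by (auto simp: permutes_def)
    then show ?thesis
      using that(4) by (simp add: image_cong)
  qed (use that in \<open>auto simp: ktuples_in_def\<close>)
  moreover have "\<omega> ` p \<subseteq> d" if "\<omega> permutes d" "p \<subseteq> d" for p
    using that by (metis image_mono permutes_image)
  ultimately show ?thesis
    by (fastforce simp: kpperms_def B_group_def ktuples_in_def)
qed

lemma kpperms_mult:
  assumes "0 < k" "x \<in> kpperms k" "y \<in> kpperms k"
  shows "pperm_mult x y \<in> kpperms k"
proof -
  obtain d \<omega> e \<alpha> where [simp]: "x = (d, \<omega>)" "y = (e, \<alpha>)"
    by (cases x; cases y)
  have "\<omega> permutes d \<union> e" "\<alpha> permutes d \<union> e"
    using assms by (auto simp: kpperms_iff intro: permutes_subset)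
  then have "\<omega> \<circ> \<alpha> permutes d \<union> e"
    using permutes_compose by blast
  moreover have "(\<omega> \<circ> \<alpha>) ` p \<in> ktuples k" if "p \<in> ktuples k" for p
    unfolding image_comp[symmetric] using assms that by (simp add: kpperms_iff)
  ultimately show ?thesis
    using assms by (simp add: kpperms_iff pperm_mult_def ktuple_domain_Un)
qed

lemma kpperms_permutation: "(d, \<omega>) \<in> kpperms k \<Longrightarrow> permutation \<omega>"
  using finite_ktuple_domain by (auto simp: kpperms_def B_group_def permutation_permutes)

lemma kpperms_funpow_ktuples_in:
  assumes "(d, \<omega>) \<in> kpperms k" "p \<in> ktuples_in k d"
  shows "(\<omega> ^^ i) ` p \<in> ktuples_in k d"
proof (induction i)
  case (Suc i)
  then have "\<omega> ` (\<omega> ^^ i) ` p \<in> ktuples_in k d"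
    using assms(1) by (simp add: kpperms_def B_group_def)
  then show ?case
    by (simp add: image_comp)
qed (use assms(2) in simp)

text \<open>The image map moves infinitely many sets unless \<omega> is the identity, so it need not
  be a \<open>permutation\<close> itself; the finite order of \<omega> is used instead.\<close>

lemma kpperms_self_in_orbit_image:
  assumes "(d, \<omega>) \<in> kpperms k"
  shows "p \<in> orbit ((`) \<omega>) p"
proof -
  obtain n where "0 < n" "\<omega> ^^ n = id"
    using permutation_is_nilpotent[OF kpperms_permutation[OF assms]] by blast
  then have "((`) \<omega> ^^ n) p = p"
    by (simp add: funpow_image)
  then show ?thesis
    using \<open>0 < n\<close> unfolding orbit_altdef by (metis (mono_tags, lifting) mem_Collect_eq)
qed

subsection \<open>Charts\<close>

text \<open>A list entry \<open>(\<rho>, m)\<close> stands for a cycle of \<open>m\<close> tuples that contributes the part \<open>m\<close> to the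
  partition indexed by \<open>\<rho>\<close>.\<close>

definition data_family :: "(nat multiset \<times> nat) list \<Rightarrow> family" where
  "data_family L = (\<lambda>\<rho>. image_mset snd (filter_mset (\<lambda>c. fst c = \<rho>) (mset L)))"

definition valid_data :: "nat \<Rightarrow> (nat multiset \<times> nat) list \<Rightarrow> bool" where
  "valid_data k L \<longleftrightarrow> (\<forall>c\<in>set L. fst c \<in> partitions_of k \<and> 0 < snd c)"

text \<open>Sorting merely fixes an enumeration of the parts of the multiset.\<close>

definition part :: "(nat multiset \<times> nat) list \<Rightarrow> nat \<Rightarrow> nat \<Rightarrow> nat" where
  "part L t s = sorted_list_of_multiset (fst (L ! t)) ! s"

text \<open>The length of a cycle of \<omega> that meets each of the m tuples of a tuple cycle in
  \<open>part L t s\<close> points.\<close>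

definition period :: "(nat multiset \<times> nat) list \<Rightarrow> nat \<Rightarrow> nat \<Rightarrow> nat" where
  "period L t s = snd (L ! t) * part L t s"

text \<open>The point \<open>(t, s, i)\<close> of the standard model is the \<open>i\<close>-th point of the cycle of \<open>\<omega>\<close> belonging
  to the \<open>s\<close>-th part of \<open>\<rho>\<close> in the \<open>t\<close>-th tuple cycle \<open>(\<rho>, m)\<close>. The permutation increments \<open>i\<close>, so that
  the points with equal \<open>t\<close> and equal \<open>i mod m\<close> form a tuple.\<close>

definition points :: "(nat multiset \<times> nat) list \<Rightarrow> (nat \<times> nat \<times> nat) set" where
  "points L = {(t, s, i). t < length L \<and> s < size (fst (L ! t)) \<and> i < period L t s}"

definition strand :: "(nat multiset \<times> nat) list \<Rightarrow> nat \<Rightarrow> nat \<Rightarrow> (nat \<times> nat \<times> nat) set" where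
  "strand L t s = {(t, s, i) | i. i < period L t s}"

definition block :: "(nat multiset \<times> nat) list \<Rightarrow> nat \<Rightarrow> nat \<Rightarrow> (nat \<times> nat \<times> nat) set" where
  "block L t j = {(t, s, i) | s i. (t, s, i) \<in> points L \<and> i mod snd (L ! t) = j}"

text \<open>An isomorphism from the standard model to \<open>x\<close>: it carries the increment to
  the permutation and blocks to tuples. That \<open>x\<close> is a partial permutation is not
  demanded but follows, see \<open>mem_kpperms\<close>.\<close>

definition chart ::
    "nat \<Rightarrow> (nat multiset \<times> nat) list \<Rightarrow> (nat \<times> nat \<times> nat \<Rightarrow> nat) \<Rightarrow> pperm \<Rightarrow> bool" where
  "chart k L \<theta> x \<longleftrightarrow> bij_betw \<theta> (points L) (fst x) \<and>
     (\<forall>t s i. (t, s, i) \<in> points L \<longrightarrow> snd x (\<theta> (t, s, i)) = \<theta> (t, s, Suc i mod period L t s)) \<and>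
     (\<forall>y. y \<notin> fst x \<longrightarrow> snd x y = y) \<and>
     (\<forall>t<length L. \<forall>j<snd (L ! t). \<theta> ` block L t j \<in> ktuples k)"

lemma image_mset_part:
  "image_mset (part L t) (mset_set {..<size (fst (L ! t))}) = fst (L ! t)"
proof -
  let ?xs = "sorted_list_of_multiset (fst (L ! t))"
  have "image_mset ((!) ?xs) (mset_set {..<length ?xs}) = fst (L ! t)"
    unfolding image_mset_nth_lessThan by simp
  moreover have "length ?xs = size (fst (L ! t))"
    by (metis mset_sorted_list_of_multiset size_mset)
  ultimately show ?thesis
    by (simp add: part_def[abs_def])
qed

section \<open>The standard model: strands, blocks and their sizes\<close>

locale tuple_data =
  fixes k :: nat and L :: "(nat multiset \<times> nat) list"
  assumes k_pos: "0 < k" and valid: "valid_data k L"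
begin

lemma partitions_of_nth: "t < length L \<Longrightarrow> fst (L ! t) \<in> partitions_of k"
  using valid by (simp add: valid_data_def)

lemma length_pos: "t < length L \<Longrightarrow> 0 < snd (L ! t)"
  using valid by (simp add: valid_data_def)

lemma part_pos:
  assumes "t < length L" "s < size (fst (L ! t))"
  shows "0 < part L t s"
proof -
  have "part L t s \<in># fst (L ! t)"
    using assms(2) image_mset_part[of L t] by (metis finite_lessThan finite_set_mset_mset_set
        image_eqI lessThan_iff set_image_mset)
  then show ?thesis
    using partitions_of_nth[OF assms(1)]
    by (metis (mono_tags, lifting) is_partition_def mem_Collect_eq neq0_conv partitions_of_def)
qed

lemma sum_part:
  assumes "t < length L"
  shows "(\<Sum>s<size (fst (L ! t)). part L t s) = k"
proof -
  have "(\<Sum>s<size (fst (L ! t)). part L t s) =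
      \<Sum>\<^sub># (image_mset (part L t) (mset_set {..<size (fst (L ! t))}))"
    by (simp add: sum_unfold_sum_mset)
  also have "\<dots> = k"
    using partitions_of_nth[OF assms] by (simp add: image_mset_part partitions_of_def)
  finally show ?thesis .
qed

lemma length_le_period: "t < length L \<Longrightarrow> s < size (fst (L ! t)) \<Longrightarrow> snd (L ! t) \<le> period L t s"
  using part_pos by (simp add: period_def Suc_leI)

lemma period_pos: "t < length L \<Longrightarrow> s < size (fst (L ! t)) \<Longrightarrow> 0 < period L t s"
  using part_pos length_pos by (simp add: period_def)

text \<open>The period is a multiple of the length of the tuple cycle, so wrapping around inside a
  strand does not disturb the block index.\<close>

lemma mod_period_mod: "a mod period L t s mod snd (L ! t) = a mod snd (L ! t)"
  by (simp add: period_def mod_mod_cancel)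

lemma finite_points: "finite (points L)"
proof -
  have "points L = (SIGMA t:{..<length L}. SIGMA s:{..<size (fst (L ! t))}. {..<period L t s})"
    by (auto simp: points_def)
  then show ?thesis
    by simp
qed

lemma block_subset: "block L t j \<subseteq> points L"
  by (auto simp: block_def)

lemma strand_subset: "t < length L \<Longrightarrow> s < size (fst (L ! t)) \<Longrightarrow> strand L t s \<subseteq> points L"
  by (auto simp: strand_def points_def)

lemma mem_block: "(t, s, i) \<in> points L \<Longrightarrow> (t, s, i) \<in> block L t (i mod snd (L ! t))"
  by (auto simp: block_def)

lemma card_strand_Int_block:
  assumes "t < length L" "s < size (fst (L ! t))" "j < snd (L ! t)"
  shows "card (strand L t s \<inter> block L t j) = part L t s"
proof -
  have "strand L t s \<inter> block L t j =
      (\<lambda>i. (t, s, i)) ` {i. i < snd (L ! t) * part L t s \<and> i mod snd (L ! t) = j}"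
    using assms by (auto simp: strand_def block_def points_def period_def)
  then have "card (strand L t s \<inter> block L t j) =
      card {i. i < snd (L ! t) * part L t s \<and> i mod snd (L ! t) = j}"
    by (simp add: card_image inj_on_def)
  then show ?thesis
    using card_residue_class[OF assms(3)] by simp
qed

text \<open>A block meets the s-th strand in \<open>part L t s\<close> points, and the parts add up
  to \<open>k\<close>. Blocks thus have the size of tuples, which allows \<open>ex_charted\<close>
  to place them on tuples.\<close>

lemma card_block:
  assumes "t < length L" "j < snd (L ! t)"
  shows "card (block L t j) = k"
proof -
  have "block L t j = (\<Union>s<size (fst (L ! t)). strand L t s \<inter> block L t j)"
    by (auto simp: strand_def block_def points_def)
  also have "card \<dots> = (\<Sum>s<size (fst (L ! t)). card (strand L t s \<inter> block L t j))"
  proof (rule card_UN_disjoint)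
    show "\<forall>s\<in>{..<size (fst (L ! t))}. finite (strand L t s \<inter> block L t j)"
      using finite_points block_subset by (meson finite_Int finite_subset)
  qed (auto simp: strand_def)
  also have "\<dots> = k"
    using assms card_strand_Int_block sum_part by simp
  finally show ?thesis .
qed

lemma block_nonempty: "t < length L \<Longrightarrow> j < snd (L ! t) \<Longrightarrow> block L t j \<noteq> {}"
  using card_block k_pos by fastforce

lemma point_predecessor:
  assumes "(t, s, i) \<in> points L"
  obtains i' where "(t, s, i') \<in> points L" "Suc i' mod period L t s = i"
proof (cases i)
  case 0
  then have "(t, s, period L t s - 1) \<in> points L" "Suc (period L t s - 1) mod period L t s = i"
    using assms by (auto simp: points_def)
  then show thesis
    using that by blast
next
  case (Suc i')
  then show thesis
    using assms that[of i'] by (auto simp: points_def)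
qed

lemma Suc_mod_point:
  assumes "(t, s, i) \<in> points L"
  shows "(t, s, Suc i mod period L t s) \<in> points L"
  using assms period_pos by (auto simp: points_def)

end

section \<open>Reading tuples, cycles and type off a chart\<close>

locale charted = tuple_data +
  fixes \<theta> :: "nat \<times> nat \<times> nat \<Rightarrow> nat" and d :: "nat set" and \<omega> :: "nat \<Rightarrow> nat"
  assumes chart: "chart k L \<theta> (d, \<omega>)"
begin

lemma bij: "bij_betw \<theta> (points L) d"
  using chart by (simp add: chart_def)

lemma inj: "inj_on \<theta> (points L)"
  using bij by (simp add: bij_betw_def)

lemma step: "(t, s, i) \<in> points L \<Longrightarrow> \<omega> (\<theta> (t, s, i)) = \<theta> (t, s, Suc i mod period L t s)"
  using chart by (simp add: chart_def)

lemma outside: "y \<notin> d \<Longrightarrow> \<omega> y = y"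
  using chart by (simp add: chart_def)

lemma block_ktuple: "t < length L \<Longrightarrow> j < snd (L ! t) \<Longrightarrow> \<theta> ` block L t j \<in> ktuples k"
  using chart by (simp add: chart_def)

lemma block_image_subset: "\<theta> ` block L t j \<subseteq> d"
  using bij block_subset by (metis bij_betw_imp_surj_on image_mono)

lemma domainE:
  assumes "y \<in> d"
  obtains t s i where "(t, s, i) \<in> points L" "y = \<theta> (t, s, i)"
  using assms bij by (auto simp: bij_betw_def)

text \<open>An increment raises the block index by one modulo the cycle length, even where the point
  index wraps around the period; every point of the next block has a predecessor, which gives
  equality.\<close>

lemma image_block:
  assumes "t < length L" "j < snd (L ! t)"
  shows "\<omega> ` \<theta> ` block L t j = \<theta> ` block L t (Suc j mod snd (L ! t))"
proof (intro set_eqI iffI)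
  fix y assume "y \<in> \<omega> ` \<theta> ` block L t j"
  then obtain s i where i: "(t, s, i) \<in> points L" "i mod snd (L ! t) = j" "y = \<omega> (\<theta> (t, s, i))"
    by (auto simp: block_def)
  then have "(t, s, Suc i mod period L t s) \<in> block L t (Suc j mod snd (L ! t))"
    using Suc_mod_point mod_period_mod by (auto simp: block_def mod_Suc_eq)
  then show "y \<in> \<theta> ` block L t (Suc j mod snd (L ! t))"
    using i step by simp
next
  fix y assume "y \<in> \<theta> ` block L t (Suc j mod snd (L ! t))"
  then obtain s i where i: "(t, s, i) \<in> points L" "i mod snd (L ! t) = Suc j mod snd (L ! t)"
      "y = \<theta> (t, s, i)"
    by (auto simp: block_def)
  obtain i' where i': "(t, s, i') \<in> points L" "Suc i' mod period L t s = i"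
    using point_predecessor[OF i(1)] by blast
  have "Suc i' mod snd (L ! t) = Suc j mod snd (L ! t)"
    using i(2) i'(2) mod_period_mod[of "Suc i'" t s] by simp
  then have "i' mod snd (L ! t) = j"
    using assms(2) by (auto simp: mod_Suc split: if_splits)
  then have "(t, s, i') \<in> block L t j"
    using i'(1) by (simp add: block_def)
  then show "y \<in> \<omega> ` \<theta> ` block L t j"
    using step[OF i'(1)] i'(2) i(3) by (metis imageI)
qed

text \<open>The images of the blocks are tuples that cover \<open>d\<close>, and a tuple that meets
  one of them equals it.\<close>

lemma ktuples_in_eq: "ktuples_in k d = (\<Union>t<length L. (\<lambda>j. \<theta> ` block L t j) ` {..<snd (L ! t)})"
proof (intro set_eqI iffI)
  fix p assume "p \<in> ktuples_in k d"
  then have p: "p \<in> ktuples k" "p \<subseteq> d"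
    by (auto simp: ktuples_in_def)
  obtain y where "y \<in> p"
    using ktuple_nonempty[OF k_pos p(1)] by blast
  then obtain t s i where y: "(t, s, i) \<in> points L" "\<theta> (t, s, i) \<in> p"
    using p(2) domainE by blast
  then have t: "t < length L" "i mod snd (L ! t) < snd (L ! t)"
    using length_pos by (auto simp: points_def)
  have "\<theta> (t, s, i) \<in> \<theta> ` block L t (i mod snd (L ! t))"
    using mem_block[OF y(1)] by simp
  then have "p = \<theta> ` block L t (i mod snd (L ! t))"
    using ktuples_disjoint[OF p(1) block_ktuple[OF t]] y(2) by blast
  then show "p \<in> (\<Union>t<length L. (\<lambda>j. \<theta> ` block L t j) ` {..<snd (L ! t)})"
    using t by blast
next
  fix p assume "p \<in> (\<Union>t<length L. (\<lambda>j. \<theta> ` block L t j) ` {..<snd (L ! t)})"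
  then obtain t j where "t < length L" "j < snd (L ! t)" "p = \<theta> ` block L t j"
    by blast
  then show "p \<in> ktuples_in k d"
    using block_ktuple block_image_subset by (simp add: ktuples_in_def)
qed

lemma block_image_eq_iff:
  assumes "t < length L" "j < snd (L ! t)" "t' < length L" "j' < snd (L ! t')"
  shows "\<theta> ` block L t j = \<theta> ` block L t' j' \<longleftrightarrow> t = t' \<and> j = j'"
proof
  assume "\<theta> ` block L t j = \<theta> ` block L t' j'"
  then have "block L t j = block L t' j'"
    using inj block_subset inj_on_image_eq_iff by metis
  moreover obtain a where "a \<in> block L t j"
    using block_nonempty assms by blast
  ultimately have "a \<in> block L t j" "a \<in> block L t' j'"
    by auto
  then show "t = t' \<and> j = j'"
    by (auto simp: block_def)
qed auto

lemma card_block_image_cycle: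
  assumes "t < length L"
  shows "card ((\<lambda>j. \<theta> ` block L t j) ` {..<snd (L ! t)}) = snd (L ! t)"
proof -
  have "inj_on (\<lambda>j. \<theta> ` block L t j) {..<snd (L ! t)}"
    using block_image_eq_iff assms by (meson inj_onI lessThan_iff)
  then show ?thesis
    by (simp add: card_image)
qed

lemma card_ktuples_in: "card (ktuples_in k d) = (\<Sum>c\<leftarrow>L. snd c)"
proof -
  let ?C = "\<lambda>t. (\<lambda>j. \<theta> ` block L t j) ` {..<snd (L ! t)}"
  have disj: "?C t \<inter> ?C t' = {}" if "t < length L" "t' < length L" "t \<noteq> t'" for t t'
    using block_image_eq_iff that by blast
  have "card (ktuples_in k d) = (\<Sum>t<length L. card (?C t))"
    unfolding ktuples_in_eq by (rule card_UN_disjoint) (simp_all add: disj)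
  also have "\<dots> = (\<Sum>t<length L. snd (L ! t))"
    by (intro sum.cong refl card_block_image_cycle) simp
  also have "\<dots> = (\<Sum>c\<leftarrow>L. snd c)"
    by (simp add: sum_list_sum_nth lessThan_atLeast0)
  finally show ?thesis .
qed

lemma mem_kpperms: "(d, \<omega>) \<in> kpperms k"
proof -
  have "\<theta> ` points L = d"
    using bij by (simp add: bij_betw_def)
  then have fin: "finite d"
    using finite_points by blast
  have "d = \<Union>(ktuples_in k d)"
  proof
    show "d \<subseteq> \<Union>(ktuples_in k d)"
    proof
      fix y assume "y \<in> d"
      then obtain t s i where y: "(t, s, i) \<in> points L" "y = \<theta> (t, s, i)"
        by (rule domainE)
      then have "t < length L" "i mod snd (L ! t) < snd (L ! t)"
        using length_pos by (auto simp: points_def)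
      then show "y \<in> \<Union>(ktuples_in k d)"
        using mem_block[OF y(1)] y(2) by (auto simp: ktuples_in_eq)
    qed
  qed (auto simp: ktuples_in_def)
  moreover have "finite (ktuples_in k d)"
    by (simp add: ktuples_in_eq)
  ultimately have dom: "ktuple_domain k d"
    unfolding ktuple_domain_def by (metis (no_types, lifting) ktuples_in_def mem_Collect_eq subsetI)
  have "\<omega> ` d = d"
  proof (intro set_eqI iffI)
    fix y assume "y \<in> \<omega> ` d"
    then show "y \<in> d"
      using domainE step Suc_mod_point bij by (metis bij_betwE imageE)
  next
    fix y assume "y \<in> d"
    then obtain t s i where y: "(t, s, i) \<in> points L" "y = \<theta> (t, s, i)"
      by (rule domainE)
    obtain i' where i': "(t, s, i') \<in> points L" "Suc i' mod period L t s = i"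
      using point_predecessor[OF y(1)] by blast
    then have "\<omega> (\<theta> (t, s, i')) = y"
      using step y(2) by simp
    then show "y \<in> \<omega> ` d"
      using i'(1) bij_betwE[OF bij] by blast
  qed
  \<comment> \<open>Surjectivity on a finite set gives injectivity.\<close>
  then have "bij_betw \<omega> d d"
    using fin by (simp add: bij_betw_def eq_card_imp_inj_on)
  then have "\<omega> permutes d"
    using outside bij_imp_permutes by blast
  moreover have "\<omega> ` p \<in> ktuples_in k d" if "p \<in> ktuples_in k d" for p
    using that length_pos by (fastforce simp: ktuples_in_eq image_block)
  ultimately show ?thesis
    using dom by (simp add: kpperms_def B_group_def)
qed

lemma funpow_point:
  assumes "(t, s, j) \<in> points L"
  shows "(\<omega> ^^ i) (\<theta> (t, s, j)) = \<theta> (t, s, (j + i) mod period L t s)"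
proof (induction i)
  case 0
  then show ?case
    using assms by (simp add: points_def)
next
  case (Suc i)
  have "(t, s, (j + i) mod period L t s) \<in> points L"
    using assms by (auto simp: points_def)
  then show ?case
    using Suc by (simp add: step mod_Suc_eq)
qed

lemma orbit_point:
  assumes "(t, s, j) \<in> points L"
  shows "orbit \<omega> (\<theta> (t, s, j)) = \<theta> ` strand L t s"
proof -
  let ?N = "period L t s"
  have N: "0 < ?N" "j < ?N"
    using assms by (auto simp: points_def)
  have "(\<omega> ^^ ?N) (\<theta> (t, s, j)) = \<theta> (t, s, j)"
    using N(2) by (simp add: funpow_point[OF assms])
  then have "orbit \<omega> (\<theta> (t, s, j)) = {(\<omega> ^^ i) (\<theta> (t, s, j)) | i. i < ?N}"
    using N(1) by (rule orbit_altdef_bounded)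
  also have "\<dots> = {\<theta> (t, s, (j + i) mod ?N) | i. i < ?N}"
    by (simp add: funpow_point[OF assms])
  also have "\<dots> = \<theta> ` strand L t s"
  proof (intro set_eqI iffI)
    fix y assume "y \<in> \<theta> ` strand L t s"
    then obtain i where i: "i < ?N" "y = \<theta> (t, s, i)"
      by (auto simp: strand_def)
    \<comment> \<open>The witness is the number of steps from index \<open>j\<close> to index
      \<open>i\<close>; adding the period first keeps the natural subtraction from
      truncating.\<close>
    have "(j + (i + ?N - j) mod ?N) mod ?N = i"
      using i(1) N by (simp add: mod_add_right_eq)
    then show "y \<in> {\<theta> (t, s, (j + i) mod ?N) | i. i < ?N}"
      using i(2) N(1) by (metis (mono_tags, lifting) mem_Collect_eq mod_less_divisor)
  qed (use N in \<open>auto simp: strand_def\<close>)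
  finally show ?thesis .
qed

lemma orbit_block:
  assumes "t < length L" "j < snd (L ! t)"
  shows "orbit ((`) \<omega>) (\<theta> ` block L t j) = (\<lambda>j. \<theta> ` block L t j) ` {..<snd (L ! t)}"
proof -
  let ?m = "snd (L ! t)"
  have pow: "((`) \<omega> ^^ i) (\<theta> ` block L t j) = \<theta> ` block L t ((j + i) mod ?m)" for i
  proof (induction i)
    case (Suc i)
    then show ?case
      using image_block[OF assms(1), of "(j + i) mod ?m"] length_pos[OF assms(1)]
      by (simp add: mod_Suc_eq)
  qed (use assms in simp)
  then have "((`) \<omega> ^^ ?m) (\<theta> ` block L t j) = \<theta> ` block L t j"
    using assms(2) by simp
  then have "orbit ((`) \<omega>) (\<theta> ` block L t j) = {((`) \<omega> ^^ i) (\<theta> ` block L t j) | i. i < ?m}"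
    using length_pos[OF assms(1)] by (rule orbit_altdef_bounded)
  also have "\<dots> = (\<lambda>j. \<theta> ` block L t j) ` {..<?m}"
  proof (intro set_eqI iffI)
    fix p assume "p \<in> (\<lambda>j. \<theta> ` block L t j) ` {..<?m}"
    then obtain i where i: "i < ?m" "p = \<theta> ` block L t i"
      by auto
    have "(j + (i + ?m - j) mod ?m) mod ?m = i"
      using i(1) assms(2) by (simp add: mod_add_right_eq)
    moreover have "(i + ?m - j) mod ?m < ?m"
      using i(1) by simp
    ultimately show "p \<in> {((`) \<omega> ^^ i) (\<theta> ` block L t j) | i. i < ?m}"
      using i(2) pow by (metis (mono_tags, lifting) mem_Collect_eq)
  qed (use length_pos[OF assms(1)] in \<open>auto simp: pow\<close>)
  finally show ?thesis .
qed

lemma tuple_partition_block: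
  assumes "t < length L" "j < snd (L ! t)"
  shows "tuple_partition \<omega> (\<theta> ` block L t j) = fst (L ! t)"
proof -
  let ?q = "size (fst (L ! t))"
  have orb: "orbit \<omega> ` \<theta> ` block L t j = (\<lambda>s. \<theta> ` strand L t s) ` {..<?q}"
  proof (intro set_eqI iffI)
    fix c assume "c \<in> orbit \<omega> ` \<theta> ` block L t j"
    then obtain s i where "(t, s, i) \<in> points L" "c = orbit \<omega> (\<theta> (t, s, i))"
      by (auto simp: block_def)
    then show "c \<in> (\<lambda>s. \<theta> ` strand L t s) ` {..<?q}"
      using orbit_point by (auto simp: points_def)
  next
    fix c assume "c \<in> (\<lambda>s. \<theta> ` strand L t s) ` {..<?q}"
    then obtain s where s: "s < ?q" "c = \<theta> ` strand L t s"
      by auto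
    \<comment> \<open>Every strand meets every block of its cycle: the index \<open>j\<close> itself
      is below the cycle length, hence below the period.\<close>
    then have "(t, s, j) \<in> points L"
      using assms length_le_period[OF assms(1) s(1)] by (auto simp: points_def)
    moreover from this have "(t, s, j) \<in> block L t j"
      using assms by (auto simp: block_def)
    ultimately show "c \<in> orbit \<omega> ` \<theta> ` block L t j"
      using orbit_point s(2) by (metis imageI)
  qed
  have "inj_on (\<lambda>s. \<theta> ` strand L t s) {..<?q}"
  proof (rule inj_onI)
    fix s s' assume s: "s \<in> {..<?q}" "s' \<in> {..<?q}" and "\<theta> ` strand L t s = \<theta> ` strand L t s'"
    then have "strand L t s = strand L t s'"
      using inj strand_subset[OF assms(1)] by (simp add: inj_on_image_eq_iff)
    moreover have "(t, s, 0) \<in> strand L t s"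
      using period_pos assms(1) s(1) by (auto simp: strand_def)
    ultimately have "(t, s, 0) \<in> strand L t s'"
      by simp
    then show "s = s'"
      by (simp add: strand_def)
  qed
  then have "tuple_partition \<omega> (\<theta> ` block L t j) =
      image_mset (\<lambda>s. card (\<theta> ` strand L t s \<inter> \<theta> ` block L t j)) (mset_set {..<?q})"
    unfolding tuple_partition_def orb
    by (simp add: multiset.map_comp comp_def flip: image_mset_mset_set)
  also have "\<dots> = image_mset (part L t) (mset_set {..<?q})"
  proof (rule image_mset_cong)
    fix s assume "s \<in># mset_set {..<?q}"
    then have s: "s < ?q"
      by simp
    have "\<theta> ` strand L t s \<inter> \<theta> ` block L t j = \<theta> ` (strand L t s \<inter> block L t j)"
      using inj_on_image_Int[OF inj strand_subset[OF assms(1) s] block_subset] by simp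
    moreover have "inj_on \<theta> (strand L t s \<inter> block L t j)"
      using inj block_subset by (meson inf.coboundedI2 inj_on_subset)
    ultimately show "card (\<theta> ` strand L t s \<inter> \<theta> ` block L t j) = part L t s"
      using card_strand_Int_block[OF assms(1) s assms(2)] by (simp add: card_image)
  qed
  finally show ?thesis
    by (simp add: image_mset_part)
qed

text \<open>The list alone determines the type. Equality of types can therefore be shown by giving
  charts from the same list, without comparing cycles.\<close>

lemma ptype_eq: "ptype k (d, \<omega>) = data_family L"
proof
  fix \<rho>
  let ?C = "\<lambda>t. (\<lambda>j. \<theta> ` block L t j) ` {..<snd (L ! t)}"
  let ?T = "{t. t < length L \<and> fst (L ! t) = \<rho>}"
  have cycles: "tuple_cycles k (d, \<omega>) = ?C ` {..<length L}"
  proof (intro set_eqI iffI)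
    fix C assume "C \<in> tuple_cycles k (d, \<omega>)"
    then show "C \<in> ?C ` {..<length L}"
      using orbit_block by (auto simp: tuple_cycles_def ktuples_in_eq)
  next
    fix C assume "C \<in> ?C ` {..<length L}"
    then obtain t where t: "t < length L" "C = ?C t"
      by auto
    then have "C = orbit ((`) \<omega>) (\<theta> ` block L t 0)"
      using orbit_block[OF t(1) length_pos[OF t(1)]] by simp
    moreover have "\<theta> ` block L t 0 \<in> ktuples_in k d"
      unfolding ktuples_in_eq using t(1) length_pos[OF t(1)] by blast
    ultimately show "C \<in> tuple_cycles k (d, \<omega>)"
      unfolding tuple_cycles_def by simp
  qed
  have inj: "inj_on ?C {..<length L}"
  proof (rule inj_onI)
    fix t t' assume t: "t \<in> {..<length L}" "t' \<in> {..<length L}" "?C t = ?C t'"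
    then have "\<theta> ` block L t 0 \<in> ?C t'"
      using length_pos by (metis imageI lessThan_iff)
    then show "t = t'"
      using t(1,2) length_pos by (auto simp: block_image_eq_iff)
  qed
  have card: "card (?C t) = snd (L ! t)" if "t < length L" for t
    using card_block_image_cycle that .
  \<comment> \<open>Whichever tuple \<open>SOME\<close> picks, it is a block of the t-th cycle, and
    all those blocks have the same partition.\<close>
  have part: "cycle_partition \<omega> (?C t) = fst (L ! t)" if "t < length L" for t
  proof -
    have "\<theta> ` block L t 0 \<in> ?C t"
      using that length_pos by simp
    then have "(SOME p. p \<in> ?C t) \<in> ?C t"
      by (rule someI)
    then obtain j where "j < snd (L ! t)" "(SOME p. p \<in> ?C t) = \<theta> ` block L t j"
      by auto
    then show ?thesis
      unfolding cycle_partition_def using tuple_partition_block[OF that] by simp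
  qed
  have "{C \<in> tuple_cycles k (d, \<omega>). cycle_partition \<omega> C = \<rho>} = ?C ` ?T"
    unfolding cycles using part by auto
  then have "ptype k (d, \<omega>) \<rho> = image_mset card (mset_set (?C ` ?T))"
    by (simp add: ptype_def)
  also have "\<dots> = image_mset (\<lambda>t. card (?C t)) (mset_set ?T)"
    using inj_on_subset[OF inj, of ?T] by (simp add: multiset.map_comp comp_def subset_iff
        flip: image_mset_mset_set)
  also have "\<dots> = image_mset (\<lambda>t. snd (L ! t)) (mset_set ?T)"
    using card by (intro image_mset_cong) simp
  also have "\<dots> = data_family L \<rho>"
    unfolding data_family_def
    by (simp add: filter_mset_image_mset multiset.map_comp comp_def filter_mset_mset_set
        flip: image_mset_nth_lessThan[of L])
  finally show "ptype k (d, \<omega>) \<rho> = data_family L \<rho>" .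
qed

end

section \<open>Families as lists of cycle data\<close>

lemma orbit_eq_of_mem: "x \<in> orbit f x \<Longrightarrow> y \<in> orbit f x \<Longrightarrow> orbit f y = orbit f x"
  by (intro set_eqI iffI) (rule orbit_trans, assumption, assumption,
      rule orbit_trans, assumption, rule orbit_swap)

text \<open>The fibres over all \<rho> determine the multiset of pairs, so a family fixes its list
  of cycle data up to order.\<close>

lemma count_fibre:
  "count (image_mset snd (filter_mset (\<lambda>c. fst c = \<rho>) M)) j = count M (\<rho>, j)"
  by (induction M) auto

lemma count_image_mset_Pair: "count (image_mset (Pair a) N) (b, j) = (if a = b then count N j else 0)"
  by (induction N) auto

lemma data_family_in_families: "valid_data k L \<Longrightarrow> data_family L \<in> families k"
proof -
  assume valid: "valid_data k L"
  have "m \<noteq> 0 \<and> \<rho> \<in> partitions_of k" if "m \<in># data_family L \<rho>" for m \<rho>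
    using that valid by (auto simp: data_family_def valid_data_def)
  then show ?thesis
    unfolding families_def is_partition_def by (blast dest: multiset_nonemptyE)
qed

text \<open>Tag each part of each partition with its index and list all the pairs in any order; this
  is a finite list because \<open>partitions_of k\<close> is finite.\<close>

lemma families_eq_data_family:
  assumes "\<Lambda> \<in> families k"
  obtains L where "valid_data k L" "data_family L = \<Lambda>"
proof -
  let ?M = "\<Sum>\<rho>\<in>partitions_of k. image_mset (Pair \<rho>) (\<Lambda> \<rho>)"
  obtain L where L: "mset L = ?M"
    using ex_mset by blast
  have count: "count (mset L) (\<rho>, j) = count (\<Lambda> \<rho>) j" for \<rho> j
  proof -
    have "count (mset L) (\<rho>, j) = (\<Sum>\<rho>'\<in>partitions_of k. if \<rho>' = \<rho> then count (\<Lambda> \<rho>') j else 0)"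
      by (simp add: L count_sum count_image_mset_Pair)
    also have "\<dots> = count (\<Lambda> \<rho>) j"
      using assms finite_partitions_of by (simp add: families_def)
    finally show ?thesis .
  qed
  have "fst c \<in> partitions_of k \<and> 0 < snd c" if "c \<in> set L" for c
  proof -
    have "0 < count (mset L) (fst c, snd c)"
      using that by simp
    then have "snd c \<in># \<Lambda> (fst c)"
      unfolding count by simp
    then show ?thesis
      using assms unfolding families_def is_partition_def
      by (metis (mono_tags, lifting) empty_not_add_mset mem_Collect_eq multi_member_split neq0_conv)
  qed
  then have "valid_data k L"
    by (simp add: valid_data_def)
  moreover have "data_family L = \<Lambda>"
    by (intro ext multiset_eqI) (simp add: data_family_def count_fibre count)
  ultimately show thesis
    using that by blast
qed

lemma family_size_data_family:
  assumes "valid_data k L"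
  shows "family_size k (data_family L) = (\<Sum>c\<leftarrow>L. snd c)"
  using assms
proof (induction L)
  case Nil
  then show ?case
    by (simp add: family_size_def data_family_def)
next
  case (Cons c L)
  have c: "fst c \<in> partitions_of k" and v: "valid_data k L"
    using Cons.prems by (simp_all add: valid_data_def)
  have "family_size k (data_family (c # L)) =
      (\<Sum>\<rho>\<in>partitions_of k. (if fst c = \<rho> then snd c else 0) + \<Sum>\<^sub># (data_family L \<rho>))"
    unfolding family_size_def by (intro sum.cong) (auto simp: data_family_def)
  also have "\<dots> = snd c + family_size k (data_family L)"
    using c finite_partitions_of by (simp add: sum.distrib family_size_def)
  finally show ?case
    using Cons.IH[OF v] by simp
qed

section \<open>Every partial permutation has a chart\<close>

context
  fixes k :: nat and d :: "nat set" and \<omega> :: "nat \<Rightarrow> nat"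
  assumes k_pos: "0 < k" and mem: "(d, \<omega>) \<in> kpperms k"
begin

lemma kpperm_domain: "ktuple_domain k d"
  using mem by (simp add: kpperms_def)

lemma self_in_orbit: "a \<in> orbit \<omega> a"
  using permutation_self_in_orbit[OF kpperms_permutation[OF mem]] .

lemma self_in_orbit_image: "p \<in> orbit ((`) \<omega>) p"
  using kpperms_self_in_orbit_image[OF mem] .

text \<open>The orbits cut \<open>p\<close> into disjoint nonempty pieces, whose sizes add up to
  \<open>card p\<close>.\<close>

lemma tuple_partition_mem:
  assumes "p \<in> ktuples_in k d"
  shows "tuple_partition \<omega> p \<in> partitions_of k"
proof -
  have p: "finite p" "card p = k"
    using assms finite_ktuple card_ktuple by (auto simp: ktuples_in_def)
  have "0 \<notin># tuple_partition \<omega> p"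
    using p(1) self_in_orbit by (fastforce simp: tuple_partition_def)
  moreover have "\<Sum>\<^sub># (tuple_partition \<omega> p) = (\<Sum>c\<in>orbit \<omega> ` p. card (c \<inter> p))"
    by (simp add: tuple_partition_def sum_unfold_sum_mset)
  moreover have "(\<Sum>c\<in>orbit \<omega> ` p. card (c \<inter> p)) = card (\<Union>c\<in>orbit \<omega> ` p. c \<inter> p)"
  proof (rule card_UN_disjoint[symmetric])
    show "\<forall>c\<in>orbit \<omega> ` p. \<forall>c'\<in>orbit \<omega> ` p. c \<noteq> c' \<longrightarrow> (c \<inter> p) \<inter> (c' \<inter> p) = {}"
      using orbit_eq_of_mem[OF self_in_orbit] by blast
  qed (use p(1) in auto)
  moreover have "(\<Union>c\<in>orbit \<omega> ` p. c \<inter> p) = p"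
    using self_in_orbit by blast
  ultimately show ?thesis
    using p(2) by (simp add: partitions_of_def is_partition_def)
qed

lemma some_mem_cycle:
  assumes "C \<in> tuple_cycles k (d, \<omega>)"
  shows "(SOME p. p \<in> C) \<in> ktuples_in k d" and "orbit ((`) \<omega>) (SOME p. p \<in> C) = C"
proof -
  obtain q where q: "q \<in> ktuples_in k d" "C = orbit ((`) \<omega>) q"
    using assms by (auto simp: tuple_cycles_def)
  have "q \<in> C"
    using q(2) self_in_orbit_image by simp
  then have s: "(SOME p. p \<in> C) \<in> orbit ((`) \<omega>) q"
    using someI q(2) by metis
  then show "orbit ((`) \<omega>) (SOME p. p \<in> C) = C"
    using orbit_eq_of_mem[OF self_in_orbit_image] q(2) by simp
  show "(SOME p. p \<in> C) \<in> ktuples_in k d"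
    using s kpperms_funpow_ktuples_in[OF mem q(1)] by (auto simp: orbit_altdef funpow_image)
qed

lemma finite_tuple_cycles: "finite (tuple_cycles k (d, \<omega>))"
  using finite_ktuples_in[OF kpperm_domain] by (simp add: tuple_cycles_def)

lemma funpow_ktuple: "p \<in> ktuples_in k d \<Longrightarrow> (\<omega> ^^ i) ` p \<in> ktuples k"
  using kpperms_funpow_ktuples_in[OF mem] by (simp add: ktuples_in_def)

text \<open>Tuples that share a point coincide, so membership of a point becomes an equality of
  tuples, which the length of the tuple cycle decides.\<close>

lemma funpow_mem_image_iff:
  assumes "p \<in> ktuples_in k d" "a \<in> p"
  shows "(\<omega> ^^ i) a \<in> (\<omega> ^^ j) ` p \<longleftrightarrow>
    i mod card (orbit ((`) \<omega>) p) = j mod card (orbit ((`) \<omega>) p)"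
proof -
  note t = funpow_ktuple[OF assms(1)]
  have "(\<omega> ^^ i) a \<in> (\<omega> ^^ j) ` p \<longleftrightarrow> (\<omega> ^^ i) ` p = (\<omega> ^^ j) ` p"
    using ktuples_disjoint[OF t t] assms(2) by blast
  also have "\<dots> \<longleftrightarrow> i mod card (orbit ((`) \<omega>) p) = j mod card (orbit ((`) \<omega>) p)"
    using funpow_eq_iff_mod_card_orbit[OF self_in_orbit_image, of i p j] by (simp add: funpow_image)
  finally show ?thesis .
qed

text \<open>The orbit of \<open>a\<close> is in \<open>p\<close> exactly at the times divisible by
  the length of the tuple cycle. The return to \<open>a\<close> is such a time, so the orbit length
  is a multiple of it, and counting visits gives the other factor. This is the formula defining
  \<open>period\<close>.\<close>

lemma card_orbit_eq:
  assumes "p \<in> ktuples_in k d" "a \<in> p"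
  shows "card (orbit \<omega> a) = card (orbit ((`) \<omega>) p) * card (orbit \<omega> a \<inter> p)"
proof -
  let ?m = "card (orbit ((`) \<omega>) p)" and ?N = "card (orbit \<omega> a)"
  note o = orbit_eq_image_lessThan_card[OF self_in_orbit, of a]
  have m: "(\<omega> ^^ i) a \<in> p \<longleftrightarrow> i mod ?m = 0" for i
    using funpow_mem_image_iff[OF assms, of i 0] by simp
  have "?N mod ?m = 0"
    using o(3) assms(2) by (simp flip: m)
  then obtain r where r: "?N = ?m * r"
    by auto
  have "orbit \<omega> a \<inter> p = (\<lambda>i. (\<omega> ^^ i) a) ` {i. i < ?N \<and> i mod ?m = 0}"
    using m by (subst o(1)) auto
  moreover have "inj_on (\<lambda>i. (\<omega> ^^ i) a) {i. i < ?N \<and> i mod ?m = 0}"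
    using o(2) by (rule inj_on_subset) auto
  ultimately have "card (orbit \<omega> a \<inter> p) = card {i. i < ?m * r \<and> i mod ?m = 0}"
    by (simp add: card_image r)
  also have "\<dots> = r"
    using card_orbit_pos[OF self_in_orbit_image] by (rule card_residue_class)
  finally show ?thesis
    using r by simp
qed

lemma ptype_eq_fibre:
  "ptype k (d, \<omega>) \<rho> = image_mset snd (filter_mset (\<lambda>c. fst c = \<rho>)
     (image_mset (\<lambda>C. (cycle_partition \<omega> C, card C)) (mset_set (tuple_cycles k (d, \<omega>)))))"
  using finite_tuple_cycles
  by (simp add: ptype_def filter_mset_image_mset multiset.map_comp comp_def filter_mset_mset_set)

lemma ex_data:
  obtains L where "valid_data k L" "ptype k (d, \<omega>) = data_family L"
proof -
  obtain L where L: "mset L =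
      image_mset (\<lambda>C. (cycle_partition \<omega> C, card C)) (mset_set (tuple_cycles k (d, \<omega>)))"
    using ex_mset by blast
  have "fst c \<in> partitions_of k \<and> 0 < snd c" if c: "c \<in> set L" for c
  proof -
    have "c \<in># mset L"
      using c by simp
    then obtain C where C: "C \<in> tuple_cycles k (d, \<omega>)" "c = (cycle_partition \<omega> C, card C)"
      unfolding L using finite_tuple_cycles by auto
    have "0 < card C"
      using some_mem_cycle(2)[OF C(1)] card_orbit_pos[OF self_in_orbit_image] by metis
    then show ?thesis
      using tuple_partition_mem[OF some_mem_cycle(1)[OF C(1)]] C(2) by (simp add: cycle_partition_def)
  qed
  then have "valid_data k L"
    by (simp add: valid_data_def)
  moreover have "ptype k (d, \<omega>) = data_family L"
    by (simp add: fun_eq_iff ptype_eq_fibre data_family_def L)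
  ultimately show thesis
    using that by blast
qed

text \<open>One starting point for each orbit through the chosen tuple, numbered so that the orbit
  sizes inside the tuple match the enumerated parts. All starting points lie in one tuple, so in the
  chart the time modulo the cycle length tells the tuple.\<close>

lemma ex_cycle_base_points:
  assumes "C \<in> tuple_cycles k (d, \<omega>)" "cycle_partition \<omega> C = fst (L ! t)"
  shows "\<exists>a. (\<forall>s<size (fst (L ! t)). a s \<in> (SOME p. p \<in> C) \<and>
       card (orbit \<omega> (a s) \<inter> (SOME p. p \<in> C)) = part L t s) \<and>
     bij_betw (\<lambda>s. orbit \<omega> (a s)) {..<size (fst (L ! t))} (orbit \<omega> ` (SOME p. p \<in> C))"
proof -
  define p where "p = (SOME p. p \<in> C)"
  let ?q = "size (fst (L ! t))"
  have "finite p"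
    using some_mem_cycle(1)[OF assms(1)] finite_ktuple by (auto simp: ktuples_in_def p_def)
  moreover have "image_mset (part L t) (mset_set {..<?q}) =
      image_mset (\<lambda>c. card (c \<inter> p)) (mset_set (orbit \<omega> ` p))"
    using assms(2) by (simp add: image_mset_part cycle_partition_def tuple_partition_def p_def)
  ultimately obtain c where c: "bij_betw c {..<?q} (orbit \<omega> ` p)"
      "\<And>s. s \<in> {..<?q} \<Longrightarrow> card (c s \<inter> p) = part L t s"
    using image_mset_mset_set_eq_imp_bij[of "{..<?q}" "orbit \<omega> ` p" "part L t"] by blast
  define a where "a s = (SOME a. a \<in> p \<and> orbit \<omega> a = c s)" for s
  have a: "a s \<in> p \<and> orbit \<omega> (a s) = c s" if "s < ?q" for s
  proof -
    have "c s \<in> orbit \<omega> ` p"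
      using bij_betwE[OF c(1)] that by simp
    then have "\<exists>a. a \<in> p \<and> orbit \<omega> a = c s"
      by auto
    then show ?thesis
      unfolding a_def by (rule someI_ex)
  qed
  have "bij_betw (\<lambda>s. orbit \<omega> (a s)) {..<?q} (orbit \<omega> ` p) \<longleftrightarrow> bij_betw c {..<?q} (orbit \<omega> ` p)"
    using a by (intro bij_betw_cong) simp
  then show ?thesis
    unfolding p_def[symmetric] using a c by (intro exI[of _ a]) simp
qed

text \<open>Any list representing the type will do, not just one built from \<omega>. This freedom
  lets two partial permutations of equal type share a list.\<close>

lemma ex_chart:
  assumes valid: "valid_data k L" and type: "ptype k (d, \<omega>) = data_family L"
  shows "\<exists>\<theta>. chart k L \<theta> (d, \<omega>)"
proof -
  interpret tuple_data k L
    using k_pos valid by unfold_locales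
  let ?cyc = "tuple_cycles k (d, \<omega>)" and ?n = "length L"
  \<comment> \<open>The types agree fibre by fibre; assembling the fibres gives equal multisets of
    pairs, and hence a matching \<open>g\<close> of list positions with tuple cycles.\<close>
  have "image_mset ((!) L) (mset_set {..<?n}) =
      image_mset (\<lambda>C. (cycle_partition \<omega> C, card C)) (mset_set ?cyc)" (is "?A = ?B")
  proof (rule multiset_eqI)
    fix c :: "nat multiset \<times> nat"
    have "count ?A (fst c, snd c) = count (data_family L (fst c)) (snd c)"
      by (simp add: data_family_def count_fibre image_mset_nth_lessThan)
    also have "\<dots> = count ?B (fst c, snd c)"
      by (simp add: ptype_eq_fibre count_fibre flip: type)
    finally show "count ?A c = count ?B c"
      by simp
  qed
  then obtain g where g: "bij_betw g {..<?n} ?cyc"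
      "\<And>t. t \<in> {..<?n} \<Longrightarrow> (cycle_partition \<omega> (g t), card (g t)) = L ! t"
    using image_mset_mset_set_eq_imp_bij[OF _ finite_tuple_cycles] by blast
  define p where "p t = (SOME p. p \<in> g t)" for t
  have g_mem: "g t \<in> ?cyc" if "t < ?n" for t
    using that g(1) bij_betwE by fastforce
  have p: "p t \<in> ktuples_in k d" and orb_p: "orbit ((`) \<omega>) (p t) = g t" if "t < ?n" for t
    using some_mem_cycle[OF g_mem[OF that]] by (simp_all add: p_def)
  have card_p: "card (orbit ((`) \<omega>) (p t)) = snd (L ! t)" if "t < ?n" for t
    using g(2)[of t] orb_p that by (metis lessThan_iff snd_conv)
  have "\<forall>t\<in>{..<?n}. \<exists>a. (\<forall>s<size (fst (L ! t)). a s \<in> p t \<and>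
       card (orbit \<omega> (a s) \<inter> p t) = part L t s) \<and>
     bij_betw (\<lambda>s. orbit \<omega> (a s)) {..<size (fst (L ! t))} (orbit \<omega> ` p t)"
    unfolding p_def using g(2) ex_cycle_base_points g_mem by (metis fst_conv lessThan_iff)
  from bchoice[OF this] obtain a where a0: "\<forall>t\<in>{..<?n}. (\<forall>s<size (fst (L ! t)). a t s \<in> p t \<and>
       card (orbit \<omega> (a t s) \<inter> p t) = part L t s) \<and>
     bij_betw (\<lambda>s. orbit \<omega> (a t s)) {..<size (fst (L ! t))} (orbit \<omega> ` p t)"
    ..
  have a: "a t s \<in> p t" and card_a: "card (orbit \<omega> (a t s)) = period L t s"
    if "t < ?n" "s < size (fst (L ! t))" for t s
    using a0 that card_orbit_eq[OF p[OF that(1)], of "a t s"] card_p[OF that(1)]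
    by (auto simp: period_def)
  have bij_a: "bij_betw (\<lambda>s. orbit \<omega> (a t s)) {..<size (fst (L ! t))} (orbit \<omega> ` p t)"
    if "t < ?n" for t
    using a0 that by simp
  \<comment> \<open>The third coordinate is the time elapsed since the starting point
    \<open>a t s\<close>.\<close>
  define \<theta> where "\<theta> = (\<lambda>(t, s, i). (\<omega> ^^ i) (a t s))"
  have \<theta>: "\<theta> (t, s, i) = (\<omega> ^^ i) (a t s)" for t s i
    by (simp add: \<theta>_def)
  have block: "\<theta> ` block L t j = (\<omega> ^^ j) ` p t" if t: "t < ?n" and j: "j < snd (L ! t)" for t j
  proof (intro set_eqI iffI)
    fix y assume "y \<in> \<theta> ` block L t j"
    then obtain s i where i: "s < size (fst (L ! t))" "i mod snd (L ! t) = j" "y = (\<omega> ^^ i) (a t s)"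
      by (auto simp: block_def points_def \<theta>)
    then show "y \<in> (\<omega> ^^ j) ` p t"
      using funpow_mem_image_iff[OF p[OF t] a[OF t], of s i j] card_p[OF t] j by simp
  next
    fix y assume y: "y \<in> (\<omega> ^^ j) ` p t"
    then obtain y' where y': "y' \<in> p t" "y = (\<omega> ^^ j) y'"
      by auto
    have "orbit \<omega> y' \<in> (\<lambda>s. orbit \<omega> (a t s)) ` {..<size (fst (L ! t))}"
      unfolding bij_betw_imp_surj_on[OF bij_a[OF t]] using y'(1) by simp
    then obtain s where s: "s < size (fst (L ! t))" "orbit \<omega> y' = orbit \<omega> (a t s)"
      by blast
    have "y \<in> orbit \<omega> y'"
      using y'(2) funpow_in_orbit[OF self_in_orbit] by simp
    then have "y \<in> (\<lambda>i. (\<omega> ^^ i) (a t s)) ` {..<period L t s}"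
      using orbit_eq_image_lessThan_card(1)[OF self_in_orbit, of "a t s"] s card_a[OF t] by simp
    then obtain i where i: "i < period L t s" "y = (\<omega> ^^ i) (a t s)"
      by auto
    then have "i mod snd (L ! t) = j"
      using funpow_mem_image_iff[OF p[OF t] a[OF t s(1)], of i j] y card_p[OF t] j by simp
    then have "(t, s, i) \<in> block L t j"
      using i t s by (auto simp: block_def points_def)
    then show "y \<in> \<theta> ` block L t j"
      using i(2) by (force simp: \<theta>)
  qed
  \<comment> \<open>A point gives back its coordinates in turn: the cycle of its tuple determines
    \<open>t\<close>, its own orbit determines \<open>s\<close>, and the time modulo the period
    determines \<open>i\<close>.\<close>
  have inj: "inj_on \<theta> (points L)"
  proof (rule inj_onI)
    fix u v assume uv: "u \<in> points L" "v \<in> points L" "\<theta> u = \<theta> v"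
    obtain t s i t' s' i' where u: "u = (t, s, i)" and v: "v = (t', s', i')"
      by (metis prod_cases3)
    have pt: "(t, s, i) \<in> points L" "(t', s', i') \<in> points L"
      and eq: "\<theta> (t, s, i) = \<theta> (t', s', i')"
      using uv u v by simp_all
    have t: "t < ?n" "s < size (fst (L ! t))" "i < period L t s"
      and t': "t' < ?n" "s' < size (fst (L ! t'))" "i' < period L t' s'"
      using pt by (auto simp: points_def)
    have eq': "(\<omega> ^^ i) (a t s) = (\<omega> ^^ i') (a t' s')"
      using eq by (simp add: \<theta>)
    have y: "(\<omega> ^^ i) (a t s) \<in> (\<omega> ^^ i) ` p t" "(\<omega> ^^ i) (a t s) \<in> (\<omega> ^^ i') ` p t'"
      using imageI[OF a[OF t(1,2)], of "\<omega> ^^ i"] imageI[OF a[OF t'(1,2)], of "\<omega> ^^ i'"]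
      by (simp_all only: eq')
    have "(\<omega> ^^ i) ` p t \<in> ktuples k" "(\<omega> ^^ i') ` p t' \<in> ktuples k"
      using funpow_ktuple[OF p[OF t(1)]] funpow_ktuple[OF p[OF t'(1)]] by auto
    then have "(\<omega> ^^ i) ` p t = (\<omega> ^^ i') ` p t'"
      using y by (rule ktuples_disjoint)
    moreover have orb: "orbit ((`) \<omega>) ((\<omega> ^^ i) ` q) = orbit ((`) \<omega>) q" for i q
      using orbit_eq_of_mem[OF self_in_orbit_image funpow_in_orbit[OF self_in_orbit_image]]
      by (simp add: funpow_image)
    ultimately have "g t = g t'"
      using orb[of i "p t"] orb[of i' "p t'"] orb_p[OF t(1)] orb_p[OF t'(1)] by simp
    then have tt: "t = t'"
      using inj_onD[OF bij_betw_imp_inj_on[OF g(1)]] t(1) t'(1) by simp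
    have "orbit \<omega> ((\<omega> ^^ i) b) = orbit \<omega> b" for i b
      using orbit_eq_of_mem[OF self_in_orbit funpow_in_orbit[OF self_in_orbit]] .
    from this[of i "a t s"] this[of i' "a t' s'"] eq' have "orbit \<omega> (a t s) = orbit \<omega> (a t s')"
      by (simp flip: tt)
    then have ss: "s = s'"
      using inj_onD[OF bij_betw_imp_inj_on[OF bij_a[OF t(1)]]] t(2) t'(2) tt by simp
    have "i mod period L t s = i' mod period L t s"
      using eq' funpow_eq_iff_mod_card_orbit[OF self_in_orbit, of i "a t s" i'] card_a[OF t(1,2)]
      by (simp flip: tt ss)
    then show "u = v"
      using u v tt ss t(3) t'(3) by simp
  qed
  have "\<theta> ` points L = d"
  proof (intro set_eqI iffI)
    fix y assume "y \<in> \<theta> ` points L"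
    then obtain t s i where t: "t < ?n" "s < size (fst (L ! t))" "y = (\<omega> ^^ i) (a t s)"
      by (auto simp: points_def \<theta>)
    then have "y \<in> (\<omega> ^^ i) ` p t"
      using a by simp
    then show "y \<in> d"
      using kpperms_funpow_ktuples_in[OF mem p[OF t(1)], of i] by (auto simp: ktuples_in_def)
  next
    fix y assume "y \<in> d"
    then obtain q where q: "q \<in> ktuples_in k d" "y \<in> q"
      using ktuples_inE[OF kpperm_domain] by blast
    then have "orbit ((`) \<omega>) q \<in> g ` {..<?n}"
      unfolding bij_betw_imp_surj_on[OF g(1)] by (simp add: tuple_cycles_def)
    then obtain t where t: "t < ?n" "orbit ((`) \<omega>) q = orbit ((`) \<omega>) (p t)"
      using orb_p by auto
    then have "q \<in> orbit ((`) \<omega>) (p t)"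
      using self_in_orbit_image by metis
    then obtain j where j: "j < snd (L ! t)" "q = (\<omega> ^^ j) ` p t"
      using orbit_eq_image_lessThan_card(1)[OF self_in_orbit_image, of "p t"] card_p[OF t(1)]
      by (auto simp: funpow_image)
    then have "y \<in> \<theta> ` block L t j"
      using block[OF t(1)] q(2) by simp
    then show "y \<in> \<theta> ` points L"
      using block_subset by blast
  qed
  then have "bij_betw \<theta> (points L) d"
    using inj by (simp add: bij_betw_def)
  moreover have "\<omega> (\<theta> (t, s, i)) = \<theta> (t, s, Suc i mod period L t s)" if "(t, s, i) \<in> points L" for t s i
  proof -
    have "(\<omega> ^^ Suc i) (a t s) = (\<omega> ^^ (Suc i mod period L t s)) (a t s)"
      unfolding funpow_eq_iff_mod_card_orbit[OF self_in_orbit] using that card_a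
      by (simp add: points_def)
    then show ?thesis
      by (simp add: \<theta>)
  qed
  moreover have "\<omega> y = y" if "y \<notin> d" for y
    using mem that by (auto simp: kpperms_def B_group_def permutes_def)
  moreover have "\<theta> ` block L t j \<in> ktuples k" if "t < ?n" "j < snd (L ! t)" for t j
    using block[OF that] funpow_ktuple[OF p[OF that(1)]] by simp
  ultimately have "chart k L \<theta> (d, \<omega>)"
    unfolding chart_def fst_conv snd_conv by blast
  then show ?thesis
    by (rule exI[of _ \<theta>])
qed

lemma ptype_in_families: "ptype k (d, \<omega>) \<in> families k"
proof -
  obtain L where L: "valid_data k L" "ptype k (d, \<omega>) = data_family L"
    by (rule ex_data)
  show ?thesis
    unfolding L(2) using L(1) by (rule data_family_in_families)
qed

lemma family_size_ptype: "family_size k (ptype k (d, \<omega>)) = card (ktuples_in k d)"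
proof -
  obtain L where L: "valid_data k L" "ptype k (d, \<omega>) = data_family L"
    by (rule ex_data)
  from ex_chart[OF this] obtain \<theta> where ch: "chart k L \<theta> (d, \<omega>)"
    by (elim exE)
  have "charted k L \<theta> d \<omega>"
    by (intro charted.intro charted_axioms.intro tuple_data.intro k_pos L(1) ch)
  from charted.card_ktuples_in[OF this] show ?thesis
    unfolding L(2) family_size_data_family[OF L(1)] by (rule sym)
qed

end

section \<open>Every family is a type\<close>

context tuple_data
begin

lemma ex_charted: "\<exists>\<theta> d \<omega>. charted k L \<theta> d \<omega>"
proof -
  define J where "J = (SIGMA t:{..<length L}. {..<snd (L ! t)})"
  have "finite J"
    by (simp add: J_def)
  \<comment> \<open>Injectivity of the numbering \<open>e\<close> assigns distinct tuples to
    distinct blocks; each block is then mapped bijectively onto its tuple, and the increment is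
    transported along the resulting \<theta>.\<close>
  then obtain e :: "nat \<times> nat \<Rightarrow> nat" where e: "inj_on e J"
    using finite_imp_inj_to_nat_seg by blast
  have "\<exists>\<beta>. bij_betw \<beta> (block L t j) (ktuple k (Suc (e (t, j))))"
    if "t < length L" "j < snd (L ! t)" for t j
  proof (rule finite_same_card_bij)
    show "finite (block L t j)"
      using finite_points block_subset finite_subset by blast
    show "card (block L t j) = card (ktuple k (Suc (e (t, j))))"
      using card_block[OF that] by (simp add: ktuple_Suc)
  qed (simp add: ktuple_Suc)
  then obtain \<beta> where \<beta>: "\<And>t j. t < length L \<Longrightarrow> j < snd (L ! t) \<Longrightarrow>
      bij_betw (\<beta> t j) (block L t j) (ktuple k (Suc (e (t, j))))"
    by metis
  define \<theta> where "\<theta> = (\<lambda>(t, s, i). \<beta> t (i mod snd (L ! t)) (t, s, i))"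
  have \<theta>_block: "\<theta> ` block L t j = ktuple k (Suc (e (t, j)))"
    if "t < length L" "j < snd (L ! t)" for t j
  proof -
    have "\<theta> ` block L t j = \<beta> t j ` block L t j"
      by (rule image_cong) (auto simp: \<theta>_def block_def)
    then show ?thesis
      using \<beta>[OF that] by (simp add: bij_betw_def)
  qed
  have inj: "inj_on \<theta> (points L)"
  proof (rule inj_onI)
    fix u v assume uv: "u \<in> points L" "v \<in> points L" "\<theta> u = \<theta> v"
    obtain t s i t' s' i' where u: "u = (t, s, i)" and v: "v = (t', s', i')"
      by (metis prod_cases3)
    let ?j = "i mod snd (L ! t)" and ?j' = "i' mod snd (L ! t')"
    have t: "t < length L" "?j < snd (L ! t)" and t': "t' < length L" "?j' < snd (L ! t')"
      using uv length_pos by (auto simp: u v points_def)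
    have mem: "u \<in> block L t ?j" "v \<in> block L t' ?j'"
      using uv mem_block unfolding u v by blast+
    have "\<theta> u \<in> ktuple k (Suc (e (t, ?j)))" "\<theta> u \<in> ktuple k (Suc (e (t', ?j')))"
      using mem uv(3) \<theta>_block[OF t] \<theta>_block[OF t'] by (metis imageI)+
    then have "e (t, ?j) = e (t', ?j')"
      by (simp add: mem_ktuple_Suc_iff)
    moreover have "(t, ?j) \<in> J" "(t', ?j') \<in> J"
      using t t' by (simp_all add: J_def)
    ultimately have eq: "t = t'" "?j = ?j'"
      using inj_onD[OF e] by blast+
    have "\<beta> t ?j u = \<beta> t ?j v"
      using uv(3) eq by (simp add: \<theta>_def u v)
    then show "u = v"
      using inj_onD[OF bij_betw_imp_inj_on[OF \<beta>[OF t]]] mem eq by simp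
  qed
  define d where "d = \<theta> ` points L"
  define \<omega> where "\<omega> y = (if y \<in> d then
      (case inv_into (points L) \<theta> y of (t, s, i) \<Rightarrow> \<theta> (t, s, Suc i mod period L t s)) else y)" for y
  have "\<omega> (\<theta> (t, s, i)) = \<theta> (t, s, Suc i mod period L t s)" if "(t, s, i) \<in> points L" for t s i
    using that by (simp add: \<omega>_def d_def inv_into_f_f[OF inj])
  moreover have "bij_betw \<theta> (points L) d"
    using inj by (simp add: bij_betw_def d_def)
  moreover have "\<omega> y = y" if "y \<notin> d" for y
    using that by (simp add: \<omega>_def)
  moreover have "\<theta> ` block L t j \<in> ktuples k" if "t < length L" "j < snd (L ! t)" for t j
    using \<theta>_block[OF that] by (simp add: ktuples_alt)
  ultimately have "chart k L \<theta> (d, \<omega>)"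
    unfolding chart_def fst_conv snd_conv by blast
  then show ?thesis
    using charted.intro[OF tuple_data_axioms charted_axioms.intro] by blast
qed

end

text \<open>Every coefficient of a linear combination is visible as its value at some partial
  permutation; hence the basis elements are independent.\<close>

lemma ex_pperm_of_type:
  assumes "0 < k" "\<Lambda> \<in> families k"
  obtains x where "x \<in> kpperms k" "ptype k x = \<Lambda>"
proof -
  obtain L where L: "valid_data k L" "data_family L = \<Lambda>"
    using assms(2) by (rule families_eq_data_family)
  obtain \<theta> d \<omega> where "charted k L \<theta> d \<omega>"
    using tuple_data.ex_charted[OF tuple_data.intro[OF assms(1) L(1)]] by blast
  then show thesis
    using that[of "(d, \<omega>)"] charted.mem_kpperms charted.ptype_eq L(2) by blast
qed

lemma ex_charted_of_mem:
  assumes "0 < k" "(d, \<omega>) \<in> kpperms k" "valid_data k L" "ptype k (d, \<omega>) = data_family L"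
  obtains \<theta> where "charted k L \<theta> d \<omega>"
  using ex_chart[OF assms] charted.intro[OF tuple_data.intro charted_axioms.intro] assms(1,3)
  by blast

subsection \<open>Conjugation\<close>

text \<open>The set \<open>d\<close> is separate from the domain of \<open>x\<close>, because one
  map \<open>h\<close> on the domain of a product must conjugate both factors, whose domains may be
  smaller.\<close>

definition conj_pperm :: "(nat \<Rightarrow> nat) \<Rightarrow> nat set \<Rightarrow> pperm \<Rightarrow> pperm" where
  "conj_pperm h d x =
     (h ` fst x, \<lambda>y. if y \<in> h ` d then h (snd x (inv_into d h y)) else y)"

definition tuple_bij :: "nat \<Rightarrow> (nat \<Rightarrow> nat) \<Rightarrow> nat set \<Rightarrow> nat set \<Rightarrow> bool" where
  "tuple_bij k h d d' \<longleftrightarrow> bij_betw h d d' \<and> (\<forall>p\<in>ktuples_in k d. h ` p \<in> ktuples k)"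

text \<open>Composing a chart of \<open>x\<close> with \<open>h\<close> gives a chart of the
  conjugate with the same list, and \<open>ptype_eq\<close> does the rest.\<close>

lemma conj_pperm_type:
  assumes "0 < k" and h: "tuple_bij k h d d'" and x: "x \<in> kpperms k" "fst x \<subseteq> d"
  shows "conj_pperm h d x \<in> kpperms k" and "ptype k (conj_pperm h d x) = ptype k x"
proof -
  obtain e \<alpha> where [simp]: "x = (e, \<alpha>)"
    by (cases x)
  define \<alpha>' where "\<alpha>' y = (if y \<in> h ` d then h (\<alpha> (inv_into d h y)) else y)" for y
  have conj: "conj_pperm h d x = (h ` e, \<alpha>')"
    by (simp add: conj_pperm_def \<alpha>'_def[abs_def] cong: if_cong)
  obtain L where L: "valid_data k L" "ptype k (e, \<alpha>) = data_family L"
    using ex_data[OF assms(1), of e \<alpha>] x by auto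
  obtain \<theta> where "charted k L \<theta> e \<alpha>"
    using ex_charted_of_mem[OF assms(1) _ L] x by auto
  then interpret charted k L \<theta> e \<alpha> .
  have inj_h: "inj_on h d"
    using h by (simp add: tuple_bij_def bij_betw_def)
  have e: "e \<subseteq> d"
    using x by simp
  have \<alpha>': "\<alpha>' (h y) = h (\<alpha> y)" if "y \<in> d" for y
    using that inj_h by (simp add: \<alpha>'_def)
  have "bij_betw (h \<circ> \<theta>) (points L) (h ` e)"
    using bij inj_on_imp_bij_betw[OF inj_on_subset[OF inj_h e]] bij_betw_trans by blast
  moreover have "\<alpha>' ((h \<circ> \<theta>) (t, s, i)) = (h \<circ> \<theta>) (t, s, Suc i mod period L t s)"
    if "(t, s, i) \<in> points L" for t s i
  proof -
    have "\<theta> (t, s, i) \<in> d"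
      using bij_betwE[OF bij] that e by blast
    then show ?thesis
      by (simp add: \<alpha>' step[OF that])
  qed
  \<comment> \<open>Points of \<open>d\<close> outside \<open>e\<close> are fixed by \<alpha>, so
    their images are fixed too.\<close>
  moreover have "\<alpha>' y = y" if "y \<notin> h ` e" for y
  proof (cases "y \<in> h ` d")
    case True
    then obtain z where z: "z \<in> d" "y = h z"
      by blast
    then have "z \<notin> e"
      using that by blast
    then show ?thesis
      using \<alpha>'[OF z(1)] outside z(2) by simp
  qed (simp add: \<alpha>'_def)
  moreover have "(h \<circ> \<theta>) ` block L t j \<in> ktuples k" if "t < length L" "j < snd (L ! t)" for t j
  proof -
    have "\<theta> ` block L t j \<in> ktuples_in k d"
      using block_ktuple[OF that] block_image_subset e by (auto simp: ktuples_in_def)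
    then show ?thesis
      using h unfolding image_comp[symmetric] tuple_bij_def by blast
  qed
  ultimately have "chart k L (h \<circ> \<theta>) (h ` e, \<alpha>')"
    unfolding chart_def fst_conv snd_conv by blast
  then have c: "charted k L (h \<circ> \<theta>) (h ` e) \<alpha>'"
    by (intro charted.intro charted_axioms.intro tuple_data_axioms)
  show "conj_pperm h d x \<in> kpperms k"
    using charted.mem_kpperms[OF c] conj by simp
  show "ptype k (conj_pperm h d x) = ptype k x"
    using charted.ptype_eq[OF c] conj L(2) by simp
qed

lemma kpperms_permutes: "x \<in> kpperms k \<Longrightarrow> snd x permutes fst x"
  by (auto simp: kpperms_def B_group_def)

lemma mem_superset:
  assumes "x \<in> kpperms k" "fst x \<subseteq> d" "y \<in> d"
  shows "snd x y \<in> d"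
  using permutes_in_image[OF permutes_subset[OF kpperms_permutes[OF assms(1)] assms(2)]] assms(3)
  by simp

lemma conj_pperm_mult:
  assumes "inj_on h d" "y \<in> kpperms k" "fst y \<subseteq> d"
  shows "pperm_mult (conj_pperm h d x) (conj_pperm h d y) = conj_pperm h d (pperm_mult x y)"
proof -
  have "snd (pperm_mult (conj_pperm h d x) (conj_pperm h d y)) w =
      snd (conj_pperm h d (pperm_mult x y)) w" for w
  proof (cases "w \<in> h ` d")
    case True
    then obtain v where v: "v \<in> d" "w = h v"
      by blast
    then have "snd y v \<in> d"
      using mem_superset[OF assms(2,3)] by blast
    then show ?thesis
      using v assms(1) by (simp add: pperm_mult_def conj_pperm_def)
  qed (simp add: pperm_mult_def conj_pperm_def)
  then show ?thesis
    by (auto simp: pperm_mult_def conj_pperm_def image_Un fun_eq_iff)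
qed

lemma conj_pperm_inverse:
  assumes h: "bij_betw h d d'" and g: "bij_betw g d' d" and gh: "\<And>y. y \<in> d \<Longrightarrow> g (h y) = y"
    and x: "x \<in> kpperms k" "fst x \<subseteq> d"
  shows "conj_pperm g d' (conj_pperm h d x) = x"
proof -
  have inj: "inj_on h d" and im: "g ` d' = d"
    using h g by (simp_all add: bij_betw_def)
  have inv_g: "inv_into d' g y = h y" if "y \<in> d" for y
    using inv_into_f_f[OF bij_betw_imp_inj_on[OF g], of "h y"] bij_betwE[OF h] gh that by simp
  have "g ` h ` fst x = fst x"
    using gh x(2) by (force simp: image_iff)
  moreover have "snd (conj_pperm g d' (conj_pperm h d x)) y = snd x y" for y
  proof (cases "y \<in> d")
    case True
    then have "h y \<in> h ` d"
      by simp
    then show ?thesis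
      using True mem_superset[OF x True] inj by (simp add: conj_pperm_def im inv_g gh)
  next
    case False
    then have "snd x y = y"
      using permutes_not_in[OF kpperms_permutes[OF x(1)]] x(2) by blast
    then show ?thesis
      using False by (simp add: conj_pperm_def im)
  qed
  ultimately show ?thesis
    by (auto simp: prod_eq_iff conj_pperm_def)
qed

text \<open>Chart both with the same list; the transition map from \<theta> to \<theta>' is
  \<open>h\<close>. It maps block images to block images, hence tuples to tuples in both
  directions.\<close>

lemma same_type_conj:
  assumes "0 < k" and z: "z \<in> kpperms k" "z' \<in> kpperms k" "ptype k z = ptype k z'"
  obtains h g where "tuple_bij k h (fst z) (fst z')" "tuple_bij k g (fst z') (fst z)"
    "\<And>y. y \<in> fst z \<Longrightarrow> g (h y) = y" "\<And>y. y \<in> fst z' \<Longrightarrow> h (g y) = y" "conj_pperm h (fst z) z = z'"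
proof -
  obtain d \<omega> d' \<omega>' where [simp]: "z = (d, \<omega>)" "z' = (d', \<omega>')"
    by (cases z; cases z')
  obtain L where L: "valid_data k L" "ptype k (d, \<omega>) = data_family L"
    using ex_data[OF assms(1), of d \<omega>] z by auto
  obtain \<theta> where "charted k L \<theta> d \<omega>"
    using ex_charted_of_mem[OF assms(1) _ L] z by auto
  then interpret A: charted k L \<theta> d \<omega> .
  obtain \<theta>' where "charted k L \<theta>' d' \<omega>'"
    using ex_charted_of_mem[OF assms(1) _ L(1), of d' \<omega>'] z L(2) by auto
  then interpret B: charted k L \<theta>' d' \<omega>' .
  define h where "h = \<theta>' \<circ> inv_into (points L) \<theta>"
  have h\<theta>: "h (\<theta> a) = \<theta>' a" if "a \<in> points L" for a
    using that A.inj by (simp add: h_def)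
  have bij: "bij_betw h d d'"
    unfolding h_def using bij_betw_trans[OF bij_betw_inv_into[OF A.bij] B.bij] .
  have inv_h: "inv_into d h (\<theta>' a) = \<theta> a" if "a \<in> points L" for a
    using inv_into_f_f[OF bij_betw_imp_inj_on[OF bij], of "\<theta> a"] bij_betwE[OF A.bij] h\<theta> that by simp
  have blocks: "h ` \<theta> ` block L t j = \<theta>' ` block L t j" for t j
    unfolding image_image by (rule image_cong[OF refl], rule h\<theta>, rule subsetD[OF A.block_subset])
  have blocks': "inv_into d h ` \<theta>' ` block L t j = \<theta> ` block L t j" for t j
    unfolding image_image by (rule image_cong[OF refl], rule inv_h, rule subsetD[OF A.block_subset])
  have "tuple_bij k h d d'"
    unfolding tuple_bij_def A.ktuples_in_eq using bij blocks B.block_ktuple by auto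
  moreover have "tuple_bij k (inv_into d h) d' d"
    unfolding tuple_bij_def B.ktuples_in_eq
    using bij_betw_inv_into[OF bij] blocks' A.block_ktuple by auto
  moreover have "conj_pperm h d (d, \<omega>) = (d', \<omega>')"
  proof -
    have im: "h ` d = d'"
      using bij by (simp add: bij_betw_def)
    have "(if y \<in> d' then h (\<omega> (inv_into d h y)) else y) = \<omega>' y" for y
    proof (cases "y \<in> d'")
      case True
      then obtain t s i where a: "(t, s, i) \<in> points L" "y = \<theta>' (t, s, i)"
        by (rule B.domainE)
      then show ?thesis
        using True by (simp add: inv_h A.step B.step h\<theta> A.Suc_mod_point)
    next
      case False
      then show ?thesis
        by (simp add: B.outside)
    qed
    then show ?thesis
      by (simp add: conj_pperm_def im cong: if_cong)
  qed
  ultimately show thesis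
    using that bij_betw_inv_into_left[OF bij] bij_betw_inv_into_right[OF bij] by simp
qed

subsection \<open>The degree of a partial permutation\<close>

text \<open>Fixed pointwise, not merely as a set: only then is the tuple a cycle of length 1 whose
  partition consists of ones.\<close>

definition fixed_tuples :: "nat \<Rightarrow> pperm \<Rightarrow> nat set set" where
  "fixed_tuples k x = {p \<in> ktuples_in k (fst x). \<forall>y\<in>p. snd x y = y}"

text \<open>Since \<omega> preserves \<open>p\<close>, both \<open>y\<close> and its image lie in
  the same piece of \<open>p\<close>, and a piece with one point forces them to agree. In a longer
  tuple cycle the partition can be all ones although nothing is fixed.\<close>

lemma tuple_partition_eq_ones_iff:
  assumes "(d, \<omega>) \<in> kpperms k" and p: "p \<in> ktuples_in k d" "\<omega> ` p = p"
  shows "tuple_partition \<omega> p = replicate_mset k 1 \<longleftrightarrow> (\<forall>y\<in>p. \<omega> y = y)"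
proof
  have self: "y \<in> orbit \<omega> y" for y
    using permutation_self_in_orbit[OF kpperms_permutation[OF assms(1)]] .
  have fin: "finite p" and card: "card p = k"
    using p(1) finite_ktuple card_ktuple by (auto simp: ktuples_in_def)
  {
    assume ones: "tuple_partition \<omega> p = replicate_mset k 1"
    show "\<forall>y\<in>p. \<omega> y = y"
    proof
      fix y assume y: "y \<in> p"
      then have "card (orbit \<omega> y \<inter> p) \<in># tuple_partition \<omega> p"
        using fin by (simp add: tuple_partition_def)
      then have "card (orbit \<omega> y \<inter> p) = 1"
        unfolding ones by (simp split: if_splits)
      moreover have "\<omega> y \<in> orbit \<omega> y \<inter> p" "y \<in> orbit \<omega> y \<inter> p"
        using self y p(2) orbit.base[of \<omega> y] by auto
      ultimately show "\<omega> y = y"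
        by (metis card_1_singletonE singletonD)
    qed
  next
    assume "\<forall>y\<in>p. \<omega> y = y"
    then have orb: "orbit \<omega> y = {y}" if "y \<in> p" for y
      using that by (simp add: orbit_eq_singleton_iff)
    then have "orbit \<omega> ` p = (\<lambda>y. {y}) ` p"
      by (intro image_cong) simp_all
    then have "tuple_partition \<omega> p = image_mset (\<lambda>y. card ({y} \<inter> p)) (mset_set p)"
      by (simp add: tuple_partition_def multiset.map_comp comp_def flip: image_mset_mset_set)
    also have "\<dots> = image_mset (\<lambda>_. 1) (mset_set p)"
      using fin by (intro image_mset_cong) simp
    finally show "tuple_partition \<omega> p = replicate_mset k 1"
      by (simp add: image_mset_const_eq card)
  }
qed

text \<open>A part 1 comes from a tuple cycle with a single tuple \<open>p\<close>, which \<omega>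
  therefore preserves; the index with all parts 1 then says that \<omega> fixes \<open>p\<close>
  pointwise.\<close>

lemma m1_ptype:
  assumes "0 < k" and x: "x \<in> kpperms k"
  shows "m1 (ptype k x (replicate_mset k 1)) = card (fixed_tuples k x)"
proof -
  obtain d \<omega> where [simp]: "x = (d, \<omega>)"
    by (cases x)
  have mem: "(d, \<omega>) \<in> kpperms k"
    using x by simp
  let ?\<rho> = "replicate_mset k 1"
  let ?S = "{C \<in> tuple_cycles k (d, \<omega>). cycle_partition \<omega> C = ?\<rho>}"
  have fin: "finite ?S"
    using finite_tuple_cycles[OF assms(1) mem] by simp
  have sing: "cycle_partition \<omega> {p} = tuple_partition \<omega> p" for p
    by (simp add: cycle_partition_def)
  have "{C \<in> ?S. card C = 1} = (\<lambda>p. {p}) ` fixed_tuples k x"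
  proof (intro set_eqI iffI)
    fix C assume C: "C \<in> {C \<in> ?S. card C = 1}"
    then obtain p where p: "C = {p}"
      by (auto simp: card_1_singleton_iff)
    have cyc: "{p} \<in> tuple_cycles k (d, \<omega>)"
      using C p by simp
    then have p_mem: "p \<in> ktuples_in k d" and "orbit ((`) \<omega>) p = {p}"
      using some_mem_cycle[OF assms(1) mem cyc] by simp_all
    then have "\<omega> ` p = p"
      by (simp add: orbit_eq_singleton_iff)
    moreover have "tuple_partition \<omega> p = ?\<rho>"
      using C by (simp add: p sing)
    ultimately show "C \<in> (\<lambda>p. {p}) ` fixed_tuples k x"
      using tuple_partition_eq_ones_iff[OF mem p_mem] p_mem by (simp add: p fixed_tuples_def)
  next
    fix C assume "C \<in> (\<lambda>p. {p}) ` fixed_tuples k x"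
    then obtain p where p: "C = {p}" "p \<in> ktuples_in k d" "\<forall>y\<in>p. \<omega> y = y"
      by (auto simp: fixed_tuples_def)
    then have im: "\<omega> ` p = p"
      by (simp add: image_cong)
    then have "orbit ((`) \<omega>) p = {p}"
      by (simp add: orbit_eq_singleton_iff)
    then have "C \<in> tuple_cycles k (d, \<omega>)"
      using p(1,2) unfolding tuple_cycles_def by (metis fst_conv image_eqI snd_conv)
    then show "C \<in> {C \<in> ?S. card C = 1}"
      using tuple_partition_eq_ones_iff[OF mem p(2) im] p(3) by (simp add: p(1) sing)
  qed
  then have "card {C \<in> ?S. card C = 1} = card (fixed_tuples k x)"
    by (simp add: card_image)
  moreover have "m1 (ptype k x ?\<rho>) = size (filter_mset (\<lambda>C. card C = 1) (mset_set ?S))"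
    by (simp add: m1_def ptype_def count_conv_size_mset filter_mset_image_mset eq_commute)
  ultimately show ?thesis
    using fin by (simp add: filter_mset_mset_set)
qed

lemma deg1_basis_ptype:
  assumes "0 < k" "x \<in> kpperms k"
  shows "deg1_basis k (ptype k x) = card (ktuples_in k (fst x)) + card (fixed_tuples k x)"
  using family_size_ptype[OF assms(1), of "fst x" "snd x"] m1_ptype[OF assms] assms(2)
  by (simp add: deg1_basis_def)

lemma ktuples_in_mult:
  assumes "0 < k" "x \<in> kpperms k" "y \<in> kpperms k"
  shows "ktuples_in k (fst (pperm_mult x y)) = ktuples_in k (fst x) \<union> ktuples_in k (fst y)"
  using assms ktuples_in_Un[OF assms(1), of "fst x" "fst y"]
  by (auto simp: kpperms_def pperm_mult_def)

lemma fixed_tuples_mult_subset: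
  assumes "0 < k" and x: "x \<in> kpperms k" and y: "y \<in> kpperms k"
  shows "fixed_tuples k (pperm_mult x y) \<subseteq>
    ktuples_in k (fst x) \<inter> ktuples_in k (fst y) \<union> fixed_tuples k x \<union> fixed_tuples k y"
proof
  fix p assume p: "p \<in> fixed_tuples k (pperm_mult x y)"
  have dom: "ktuple_domain k (fst x)" "ktuple_domain k (fst y)"
    using x y by (auto simp: kpperms_def)
  have fixed: "snd x (snd y z) = z" if "z \<in> p" for z
    using p that by (simp add: fixed_tuples_def pperm_mult_def)
  have p_mem: "p \<in> ktuples_in k (fst x) \<union> ktuples_in k (fst y)"
    using p ktuples_in_mult[OF assms] by (simp add: fixed_tuples_def)
  then have p_tuple: "p \<in> ktuples k"
    by (auto simp: ktuples_in_def)
  consider "p \<in> ktuples_in k (fst x) \<inter> ktuples_in k (fst y)"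
    | "p \<in> ktuples_in k (fst x)" "p \<notin> ktuples_in k (fst y)"
    | "p \<in> ktuples_in k (fst y)" "p \<notin> ktuples_in k (fst x)"
    using p_mem by blast
  then show "p \<in> ktuples_in k (fst x) \<inter> ktuples_in k (fst y) \<union> fixed_tuples k x \<union> fixed_tuples k y"
  proof cases
    case 2
    then have "p \<inter> fst y = {}"
      using ktuple_in_domain_or_disjoint[OF dom(2) p_tuple] p_tuple by (auto simp: ktuples_in_def)
    then have "snd y z = z" if "z \<in> p" for z
      using permutes_not_in[OF kpperms_permutes[OF y]] that by blast
    then show ?thesis
      using 2 fixed by (simp add: fixed_tuples_def)
  next
    case 3
    then have "p \<inter> fst x = {}"
      using ktuple_in_domain_or_disjoint[OF dom(1) p_tuple] p_tuple by (auto simp: ktuples_in_def)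
    then have "snd x z = z" if "z \<in> p" for z
      using permutes_not_in[OF kpperms_permutes[OF x]] that by blast
    \<comment> \<open>Both \<open>z\<close> and its image under the right factor are sent to
      \<open>z\<close> by the left factor, which is injective.\<close>
    then have "snd y z = z" if "z \<in> p" for z
      using fixed[OF that] that inj_eq[OF permutes_inj[OF kpperms_permutes[OF x]]] by metis
    then show ?thesis
      using 3 by (simp add: fixed_tuples_def)
  qed simp
qed

lemma deg1_basis_mult_le:
  assumes "0 < k" and x: "x \<in> kpperms k" and y: "y \<in> kpperms k"
  shows "deg1_basis k (ptype k (pperm_mult x y)) \<le> deg1_basis k (ptype k x) + deg1_basis k (ptype k y)"
proof -
  let ?A = "ktuples_in k (fst x)" and ?B = "ktuples_in k (fst y)"
  have fin: "finite ?A" "finite ?B"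
    using x y finite_ktuples_in by (auto simp: kpperms_def)
  then have fin': "finite (fixed_tuples k x)" "finite (fixed_tuples k y)"
    by (auto simp: fixed_tuples_def)
  have "card (fixed_tuples k (pperm_mult x y)) \<le>
      card (?A \<inter> ?B \<union> fixed_tuples k x \<union> fixed_tuples k y)"
    using fin fin' by (intro card_mono fixed_tuples_mult_subset assms) auto
  also have "\<dots> \<le> card (?A \<inter> ?B) + card (fixed_tuples k x) + card (fixed_tuples k y)"
    by (meson add_le_mono1 card_Un_le order_trans)
  \<comment> \<open>The term for the common tuples is what the union lacks compared with the sum of
    the two cardinalities.\<close>
  finally show ?thesis
    using card_Un_Int[OF fin]
    by (simp add: deg1_basis_ptype assms kpperms_mult ktuples_in_mult)
qed

text \<open>Needed for the finiteness of the expansion of a product, together with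
  \<open>finite_bounded_families\<close>.\<close>

lemma family_size_mult_le:
  assumes "0 < k" and x: "x \<in> kpperms k" and y: "y \<in> kpperms k"
  shows "family_size k (ptype k (pperm_mult x y)) \<le>
    family_size k (ptype k x) + family_size k (ptype k y)"
proof -
  have s: "family_size k (ptype k x) = card (ktuples_in k (fst x))" if "x \<in> kpperms k" for x
    using family_size_ptype[OF assms(1), of "fst x" "snd x"] that by simp
  show ?thesis
    using card_Un_le by (simp add: s assms kpperms_mult ktuples_in_mult)
qed

subsection \<open>The algebra\<close>

text \<open>Each value of such a family is a partition of some number at most \<open>N\<close>, and
  there are finitely many indices.\<close>

lemma finite_bounded_families: "finite {\<Gamma> \<in> families k. family_size k \<Gamma> \<le> N}"
proof (rule finite_subset)
  let ?B = "\<Union>j\<le>N. partitions_of j"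
  show "{\<Gamma> \<in> families k. family_size k \<Gamma> \<le> N} \<subseteq>
    {f. \<forall>\<rho>. (\<rho> \<in> partitions_of k \<longrightarrow> f \<rho> \<in> ?B) \<and> (\<rho> \<notin> partitions_of k \<longrightarrow> f \<rho> = {#})}"
  proof (rule subsetI)
    fix \<Gamma> assume "\<Gamma> \<in> {\<Gamma> \<in> families k. family_size k \<Gamma> \<le> N}"
    then have \<Gamma>: "\<Gamma> \<in> families k" "family_size k \<Gamma> \<le> N"
      by auto
    have "\<Gamma> \<rho> \<in> ?B" if \<rho>: "\<rho> \<in> partitions_of k" for \<rho>
    proof -
      have "\<Sum>\<^sub># (\<Gamma> \<rho>) \<le> family_size k \<Gamma>"
        unfolding family_size_def using finite_partitions_of \<rho>
        by (intro member_le_sum[where f = "\<lambda>\<rho>. \<Sum>\<^sub># (\<Gamma> \<rho>)"]) auto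
      then show ?thesis
        using \<Gamma> \<rho> by (auto simp: families_def partitions_of_def)
    qed
    then show "\<Gamma> \<in> {f. \<forall>\<rho>. (\<rho> \<in> partitions_of k \<longrightarrow> f \<rho> \<in> ?B) \<and> (\<rho> \<notin> partitions_of k \<longrightarrow> f \<rho> = {#})}"
      using \<Gamma>(1) by (simp add: families_def)
  qed
  show "finite {f. \<forall>\<rho>. (\<rho> \<in> partitions_of k \<longrightarrow> f \<rho> \<in> ?B) \<and> (\<rho> \<notin> partitions_of k \<longrightarrow> f \<rho> = {#})}"
    by (intro finite_set_of_finite_funs finite_partitions_of) (simp add: finite_partitions_of)
qed

text \<open>Only the basis element of the type of \<open>x\<close> contributes. Finite support
  matters, since a sum over an infinite set is 0 by default.\<close>

lemma lin_comb_apply: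
  assumes "a \<in> coeff_families k"
  shows "lin_comb k a x = (if x \<in> kpperms k then a (ptype k x) else 0)"
proof -
  have fin: "finite {\<Lambda>. a \<Lambda> \<noteq> 0}"
    using assms by (simp add: coeff_families_def)
  have "lin_comb k a x =
      (\<Sum>\<Lambda> | a \<Lambda> \<noteq> 0. if \<Lambda> = ptype k x then if x \<in> kpperms k then a \<Lambda> else 0 else 0)"
    unfolding lin_comb_def by (intro sum.cong) (auto simp: C_basis_def)
  also have "\<dots> = (if x \<in> kpperms k then a (ptype k x) else 0)"
    using fin by (subst sum.delta) auto
  finally show ?thesis .
qed

text \<open>The definite description in \<open>basis_coeff\<close> is meaningful because every
  coefficient can be recovered as a value at a partial permutation of that type.\<close>

lemma basis_coeff_lin_comb:
  assumes "0 < k" and a: "a \<in> coeff_families k"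
  shows "basis_coeff k (lin_comb k a) = a"
  unfolding basis_coeff_def
proof (rule the_equality)
  fix b assume "b \<in> coeff_families k \<and> lin_comb k b = lin_comb k a"
  then have b: "b \<in> coeff_families k" "lin_comb k b = lin_comb k a"
    by auto
  have "b \<Lambda> = a \<Lambda>" for \<Lambda>
  proof (cases "\<Lambda> \<in> families k")
    case True
    obtain x where x: "x \<in> kpperms k" "ptype k x = \<Lambda>"
      using assms(1) True by (rule ex_pperm_of_type)
    then show ?thesis
      using lin_comb_apply[OF a, of x] lin_comb_apply[OF b(1), of x] b(2) by simp
  next
    case False
    then have "a \<Lambda> = 0" "b \<Lambda> = 0"
      using a b(1) by (auto simp: coeff_families_def)
    then show ?thesis
      by simp
  qed
  then show "b = a"
    by (rule ext)
qed (simp add: a)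

definition factorisations :: "nat \<Rightarrow> pperm \<Rightarrow> (pperm \<times> pperm) set" where
  "factorisations k z = {(x, y). x \<in> kpperms k \<and> y \<in> kpperms k \<and> pperm_mult x y = z}"

lemma conj_factorisation:
  assumes "0 < k" and h: "tuple_bij k h (fst z) d'" "conj_pperm h (fst z) z = z'"
    and mem: "(x, y) \<in> factorisations k z"
  shows "(conj_pperm h (fst z) x, conj_pperm h (fst z) y) \<in> factorisations k z'"
proof -
  have xy: "x \<in> kpperms k" "y \<in> kpperms k" "pperm_mult x y = z"
    using mem by (auto simp: factorisations_def)
  then have sub: "fst x \<subseteq> fst z" "fst y \<subseteq> fst z"
    by (auto simp: pperm_mult_def)
  have "inj_on h (fst z)"
    using h(1) by (simp add: tuple_bij_def bij_betw_def)
  then have "pperm_mult (conj_pperm h (fst z) x) (conj_pperm h (fst z) y) = z'"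
    using conj_pperm_mult xy(2) sub(2) xy(3) h(2) by metis
  then show ?thesis
    using conj_pperm_type(1)[OF assms(1) h(1)] xy sub by (simp add: factorisations_def)
qed

text \<open>Conjugating both factors maps the factorisations of \<open>z\<close> bijectively onto
  those of \<open>z'\<close> and preserves the types of the factors, hence the values of
  \<open>f\<close> and \<open>g\<close>.\<close>

lemma I_mult_cong_type:
  assumes "0 < k" and f: "f \<in> I_inf k" and g: "g \<in> I_inf k"
    and z: "z \<in> kpperms k" "z' \<in> kpperms k" "ptype k z = ptype k z'"
  shows "I_mult k f g z = I_mult k f g z'"
proof -
  obtain a b where a: "a \<in> coeff_families k" "f = lin_comb k a"
    and b: "b \<in> coeff_families k" "g = lin_comb k b"
    using f g by (auto simp: I_inf_def)
  obtain h h' where h: "tuple_bij k h (fst z) (fst z')" and h': "tuple_bij k h' (fst z') (fst z)"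
    and inv: "\<And>y. y \<in> fst z \<Longrightarrow> h' (h y) = y" and inv': "\<And>y. y \<in> fst z' \<Longrightarrow> h (h' y) = y"
    and conj: "conj_pperm h (fst z) z = z'"
    using assms(1) z by (rule same_type_conj) blast
  note bij = h[unfolded tuple_bij_def, THEN conjunct1]
    and bij' = h'[unfolded tuple_bij_def, THEN conjunct1]
  have conj': "conj_pperm h' (fst z') z' = z"
    using conj_pperm_inverse[OF bij bij' inv z(1)] conj by simp
  have sub: "x \<in> kpperms k" "y \<in> kpperms k" "fst x \<subseteq> fst z" "fst y \<subseteq> fst z"
    if "(x, y) \<in> factorisations k z" for x y z
    using that by (auto simp: factorisations_def pperm_mult_def)
  let ?j = "map_prod (conj_pperm h (fst z)) (conj_pperm h (fst z))"
  let ?i = "map_prod (conj_pperm h' (fst z')) (conj_pperm h' (fst z'))"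
  have "(\<Sum>(x, y)\<in>factorisations k z. f x * g y) = (\<Sum>(x, y)\<in>factorisations k z'. f x * g y)"
  proof (rule sum.reindex_bij_witness[where i = ?i and j = ?j])
    fix c assume "c \<in> factorisations k z"
    moreover obtain x y where c: "c = (x, y)"
      by (cases c)
    ultimately have mem: "(x, y) \<in> factorisations k z"
      by simp
    note s = sub[OF mem]
    show "?i (?j c) = c"
      using conj_pperm_inverse[OF bij bij' inv] s by (simp add: c)
    show "?j c \<in> factorisations k z'"
      using conj_factorisation[OF assms(1) h conj mem] by (simp add: c)
    show "(case ?j c of (x, y) \<Rightarrow> f x * g y) = (case c of (x, y) \<Rightarrow> f x * g y)"
      using conj_pperm_type[OF assms(1) h] s by (simp add: c a b lin_comb_apply)
  next
    fix c assume "c \<in> factorisations k z'"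
    moreover obtain x y where c: "c = (x, y)"
      by (cases c)
    ultimately have mem: "(x, y) \<in> factorisations k z'"
      by simp
    note s = sub[OF mem]
    show "?j (?i c) = c"
      using conj_pperm_inverse[OF bij' bij inv'] s by (simp add: c)
    show "?i c \<in> factorisations k z"
      using conj_factorisation[OF assms(1) h' conj' mem] by (simp add: c)
  qed
  then show ?thesis
    by (simp add: I_mult_def factorisations_def)
qed

lemma I_mult_lin_comb_nonzero:
  assumes "a \<in> coeff_families k" "b \<in> coeff_families k"
    and "I_mult k (lin_comb k a) (lin_comb k b) z \<noteq> 0"
  obtains x y where "x \<in> kpperms k" "y \<in> kpperms k" "pperm_mult x y = z"
    "a (ptype k x) \<noteq> 0" "b (ptype k y) \<noteq> 0"
proof -
  obtain c where "c \<in> {(x, y). x \<in> kpperms k \<and> y \<in> kpperms k \<and> pperm_mult x y = z}"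
    "(case c of (x, y) \<Rightarrow> lin_comb k a x * lin_comb k b y) \<noteq> 0"
    using assms(3) unfolding I_mult_def by (rule sum.not_neutral_contains_not_neutral)
  then show thesis
    using that by (auto simp: lin_comb_apply assms split: prod.splits)
qed

lemma I_mult_expansion:
  assumes "0 < k" and a: "a \<in> coeff_families k" and b: "b \<in> coeff_families k"
  obtains c where "c \<in> coeff_families k" "I_mult k (lin_comb k a) (lin_comb k b) = lin_comb k c"
    and "\<And>\<Gamma>. c \<Gamma> \<noteq> 0 \<Longrightarrow> \<exists>x\<in>kpperms k. \<exists>y\<in>kpperms k.
      ptype k (pperm_mult x y) = \<Gamma> \<and> a (ptype k x) \<noteq> 0 \<and> b (ptype k y) \<noteq> 0"
proof -
  let ?f = "lin_comb k a" and ?g = "lin_comb k b"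
  have mem: "?f \<in> I_inf k" "?g \<in> I_inf k"
    using a b by (auto simp: I_inf_def)
  define rep where "rep \<Gamma> = (SOME z. z \<in> kpperms k \<and> ptype k z = \<Gamma>)" for \<Gamma>
  have rep: "rep \<Gamma> \<in> kpperms k \<and> ptype k (rep \<Gamma>) = \<Gamma>" if \<Gamma>: "\<Gamma> \<in> families k" for \<Gamma>
  proof -
    obtain z where "z \<in> kpperms k \<and> ptype k z = \<Gamma>"
      using ex_pperm_of_type[OF assms(1) \<Gamma>] by blast
    then show ?thesis
      unfolding rep_def by (rule someI)
  qed
  \<comment> \<open>By \<open>I_mult_cong_type\<close> the value does not depend on the
    representative.\<close>
  define c where "c \<Gamma> = (if \<Gamma> \<in> families k then I_mult k ?f ?g (rep \<Gamma>) else 0)" for \<Gamma>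
  have supp: "\<exists>x\<in>kpperms k. \<exists>y\<in>kpperms k.
      ptype k (pperm_mult x y) = \<Gamma> \<and> a (ptype k x) \<noteq> 0 \<and> b (ptype k y) \<noteq> 0" if "c \<Gamma> \<noteq> 0" for \<Gamma>
  proof -
    have \<Gamma>: "\<Gamma> \<in> families k" "I_mult k ?f ?g (rep \<Gamma>) \<noteq> 0"
      using that by (auto simp: c_def split: if_splits)
    obtain x y where "x \<in> kpperms k" "y \<in> kpperms k" "pperm_mult x y = rep \<Gamma>"
        "a (ptype k x) \<noteq> 0" "b (ptype k y) \<noteq> 0"
      using a b \<Gamma>(2) by (rule I_mult_lin_comb_nonzero)
    then show ?thesis
      using rep[OF \<Gamma>(1)] by (intro bexI[of _ x] bexI[of _ y]) simp_all
  qed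
  have c_families: "\<Gamma> \<in> families k" if "c \<Gamma> \<noteq> 0" for \<Gamma>
    using that by (auto simp: c_def split: if_splits)
  \<comment> \<open>Each of the finitely many pairs of types in the factors bounds the size of the
    resulting type, and a bounded size leaves finitely many families.\<close>
  have "{\<Gamma>. c \<Gamma> \<noteq> 0} \<subseteq> (\<Union>\<Lambda>\<in>{\<Lambda>. a \<Lambda> \<noteq> 0}. \<Union>\<Delta>\<in>{\<Delta>. b \<Delta> \<noteq> 0}.
      {\<Gamma> \<in> families k. family_size k \<Gamma> \<le> family_size k \<Lambda> + family_size k \<Delta>})"
  proof (rule subsetI)
    fix \<Gamma> assume "\<Gamma> \<in> {\<Gamma>. c \<Gamma> \<noteq> 0}"
    then have \<Gamma>: "c \<Gamma> \<noteq> 0"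
      by simp
    then obtain x y where xy: "x \<in> kpperms k" "y \<in> kpperms k" "ptype k (pperm_mult x y) = \<Gamma>"
        "a (ptype k x) \<noteq> 0" "b (ptype k y) \<noteq> 0"
      using supp by blast
    then have "family_size k \<Gamma> \<le> family_size k (ptype k x) + family_size k (ptype k y)"
      using family_size_mult_le[OF assms(1) xy(1,2)] by simp
    then show "\<Gamma> \<in> (\<Union>\<Lambda>\<in>{\<Lambda>. a \<Lambda> \<noteq> 0}. \<Union>\<Delta>\<in>{\<Delta>. b \<Delta> \<noteq> 0}.
      {\<Gamma> \<in> families k. family_size k \<Gamma> \<le> family_size k \<Lambda> + family_size k \<Delta>})"
      using xy(4,5) c_families[OF \<Gamma>] by blast
  qed
  moreover have "finite (\<Union>\<Lambda>\<in>{\<Lambda>. a \<Lambda> \<noteq> 0}. \<Union>\<Delta>\<in>{\<Delta>. b \<Delta> \<noteq> 0}.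
      {\<Gamma> \<in> families k. family_size k \<Gamma> \<le> family_size k \<Lambda> + family_size k \<Delta>})"
    using a b by (intro finite_UN_I finite_bounded_families) (auto simp: coeff_families_def)
  ultimately have c: "c \<in> coeff_families k"
    using c_families by (auto simp: coeff_families_def intro: finite_subset)
  have "I_mult k ?f ?g z = lin_comb k c z" for z
  proof (cases "z \<in> kpperms k")
    case True
    then have fam: "ptype k z \<in> families k"
      using ptype_in_families[OF assms(1), of "fst z" "snd z"] by simp
    then show ?thesis
      using I_mult_cong_type[OF assms(1) mem True, of "rep (ptype k z)"] rep[OF fam] True
      by (simp add: lin_comb_apply[OF c] c_def)
  next
    case False
    then have none: "{(x, y). x \<in> kpperms k \<and> y \<in> kpperms k \<and> pperm_mult x y = z} = {}"
      using kpperms_mult[OF assms(1)] by auto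
    show ?thesis
      using False unfolding I_mult_def none by (simp add: lin_comb_apply[OF c])
  qed
  then show thesis
    using that c supp by blast
qed

lemma extend_degree_lin_comb:
  assumes "0 < k" "a \<in> coeff_families k" "lin_comb k a \<noteq> (\<lambda>_. 0)"
  shows "extend_degree k \<delta> (lin_comb k a) = ereal (real (Max (\<delta> ` {\<Lambda>. a \<Lambda> \<noteq> 0})))"
  using assms by (simp add: extend_degree_def basis_coeff_lin_comb)

theorem proposition4p3:
  fixes k :: nat
  assumes "0 < k"
  shows "filtration_on (I_inf k) (I_mult k) (deg1 k)"
  unfolding filtration_on_def
proof (intro ballI)
  fix f g assume "f \<in> I_inf k" "g \<in> I_inf k"
  then obtain a b where a: "a \<in> coeff_families k" "f = lin_comb k a"
    and b: "b \<in> coeff_families k" "g = lin_comb k b"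
    by (auto simp: I_inf_def)
  obtain c where c: "c \<in> coeff_families k" "I_mult k f g = lin_comb k c"
    and supp: "\<And>\<Gamma>. c \<Gamma> \<noteq> 0 \<Longrightarrow> \<exists>x\<in>kpperms k. \<exists>y\<in>kpperms k.
      ptype k (pperm_mult x y) = \<Gamma> \<and> a (ptype k x) \<noteq> 0 \<and> b (ptype k y) \<noteq> 0"
    using I_mult_expansion[OF assms a(1) b(1)] a(2) b(2) by metis
  show "deg1 k (I_mult k f g) \<le> deg1 k f + deg1 k g"
  proof (cases "I_mult k f g = (\<lambda>_. 0)")
    \<comment> \<open>The left side is then minus infinity.\<close>
    case True
    then show ?thesis
      by (simp add: deg1_def extend_degree_def)
  next
    case False
    \<comment> \<open>A nonzero product has nonzero factors, so all three degrees are maxima of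
      natural numbers.\<close>
    then have nz: "f \<noteq> (\<lambda>_. 0)" "g \<noteq> (\<lambda>_. 0)"
      by (auto simp: I_mult_def)
    let ?deg = "deg1_basis k"
    let ?max = "\<lambda>a. Max (?deg ` {\<Lambda>. a \<Lambda> \<noteq> (0 :: complex)})"
    have fin: "finite {\<Lambda>. e \<Lambda> \<noteq> 0}" if "e \<in> coeff_families k" for e
      using that by (simp add: coeff_families_def)
    \<comment> \<open>Bounding \<open>Max\<close> by bounding its elements requires a nonempty
      set.\<close>
    have "{\<Gamma>. c \<Gamma> \<noteq> 0} \<noteq> {}"
      using False c by (auto simp: lin_comb_apply fun_eq_iff split: if_splits)
    moreover have "?deg \<Gamma> \<le> ?max a + ?max b" if "c \<Gamma> \<noteq> 0" for \<Gamma>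
    proof -
      obtain x y where xy: "x \<in> kpperms k" "y \<in> kpperms k" "ptype k (pperm_mult x y) = \<Gamma>"
          "a (ptype k x) \<noteq> 0" "b (ptype k y) \<noteq> 0"
        using supp \<open>c \<Gamma> \<noteq> 0\<close> by blast
      then have "?deg \<Gamma> \<le> ?deg (ptype k x) + ?deg (ptype k y)"
        using deg1_basis_mult_le[OF assms xy(1,2)] by simp
      moreover have "?deg (ptype k x) \<le> ?max a" "?deg (ptype k y) \<le> ?max b"
        using fin a(1) b(1) xy(4,5) by (auto intro!: Max_ge)
      ultimately show ?thesis
        by linarith
    qed
    ultimately have "?max c \<le> ?max a + ?max b"
      using fin[OF c(1)] by simp
    then show ?thesis
      using extend_degree_lin_comb[OF assms] a b c False nz
      by (simp add: deg1_def flip: of_nat_add)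
  qed
qed

end
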